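(* Let $R\ge 2$ be a real number and let a linear regression model belong to $\mathcal{LM}(R)$. Let $\mathbf{\Gamma}_n$ be an admissible normalization with associated matrix $\mathbf{V}$, let $\boldsymbol{\alpha}\in\mathbb{R}^p$, and put $\xi_n=\boldsymbol{\alpha}^T\mathbf{\Gamma}_n(\boldsymbol{b}_n-\boldsymbol{\beta})$ and $\xi\sim N(0,\sigma^2\boldsymbol{\alpha}^T\mathbf{V}\boldsymbol{\alpha})$. Then for each real $r$ with $0<r<R$ the sequence of random variables $|\xi_n|^r$ is uniformly integrable, and consequently $$\mathbb{E}|\xi_n|^r\to\mathbb{E}|\xi|^r\quad\text{as } n\to\infty,$$ and, if $r$ is a positive integer, $$\mathbb{E}(\xi_n^r)\to\mathbb{E}(\xi^r)\quad\text{as } n\to\infty.$$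
   Context: Linear regression model. Fix an integer $p\ge1$, a parameter $\boldsymbol{\beta}\in\mathbb{R}^p$, a sequence of nonrandom vectors $\boldsymbol{x}_1,\boldsymbol{x}_2,\ldots\in\mathbb{R}^p$, and independent (not necessarily identically distributed) real random variables $\varepsilon_1,\varepsilon_2,\ldots$ with $\mathbb{E}(\varepsilon_i)=0$, $\mathrm{Var}(\varepsilon_i)=\sigma^2<\infty$ (the same for all $i$), and distribution functions $F_i$. For each $n$ let $\mathbf{X}_n=(\boldsymbol{x}_1,\ldots,\boldsymbol{x}_n)^T\in\mathbb{R}^{n\times p}$ and $\boldsymbol{Y}=\mathbf{X}_n\boldsymbol{\beta}+(\varepsilon_1,\ldots,\varepsilon_n)^T$. When $\mathrm{rank}(\mathbf{X}_n)=p$ the ordinary least squares estimator is $\boldsymbol{b}_n=(\mathbf{X}_n^T\mathbf{X}_n)^{-1}\mathbf{X}_n^T\boldsymbol{Y}$. Put $\mathbf{M}_n=(m_{ij;n})=\mathbf{X}_n^T\mathbf{X}_n$ and $\mathbf{D}_n=\mathrm{diag}(\sqrt{m_{11;n}},\ldots,\sqrt{m_{pp;n}})$; let $x_{i;n}$ denote the $i$-th component of $\boldsymbol{x}_n$. Assumptions: (i) $m_{ii;n}\to\infty$ as $n\to\infty$, $i=1,\ldots,p$; (ii) $x_{i;n+1}^2/m_{ii;n}\to0$ as $n\to\infty$, $i=1,\ldots,p$; (iii) $\mathbf{D}_n^{-1}\mathbf{M}_n\mathbf{D}_n^{-1}\to\mathbf{V}^{-1}$ as $n\to\infty$, with $\mathbf{V}^{-1}$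 nonsingular; (iii$'$) $n^{-1}\mathbf{X}_n^T\mathbf{X}_n\to\mathbf{V}^{-1}$ as $n\to\infty$, with $\mathbf{V}^{-1}\in\mathbb{R}^{p\times p}$ nonsingular; (iv) $\sup_{i\ge1}\int_{|u|>c}u^2\,dF_i(u)\to0$ as $c\to\infty$. For $R>0$, $\mathcal{LM}(R)$ is the family of such models for which either (i)–(iv) hold or (iii$'$) and (iv) hold, and $\sup_{i\ge1}\mathbb{E}|\varepsilon_i|^R<\infty$. Admissible normalization: $\mathbf{\Gamma}_n=\mathbf{D}_n$ if (i)–(iv) hold, with $\mathbf{V}$ from (iii); or $\mathbf{\Gamma}_n=\sqrt{n}\,\mathbf{I}_p$ if (iii$'$), (iv) hold, with $\mathbf{V}$ from (iii$'$). In either case $\mathbf{X}_n$ has rank $p$ for all sufficiently large $n$, and sequences indexed by $n$ are considered for those $n$ with $\mathrm{rank}(\mathbf{X}_n)=p$. It is known that $\mathbf{\Gamma}_n(\boldsymbol{b}_n-\boldsymbol{\beta})$ converges in distribution to $N_p(\boldsymbol{0},\sigma^2\mathbf{V})$. *)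

theory Defs
  imports "HOL-Probability.Probability"
begin

text \<open>
  All sequences of regressors, errors and responses start at index 1; their value at index 0
  is irrelevant.  The dimension p is the cardinality of the index type \<open>'p\<close>, hence p is at least 1.
  The matrix X_n, with rows x 1, ..., x n, has a varying number of rows, so it is not a
  value of a single matrix type; the three expressions in which it occurs are written out.
\<close>

text \<open>The rank of X_n as the dimension of its row space, cf. \<open>row_rank_def\<close>.\<close>

definition design_rank :: "(nat \<Rightarrow> real^'p) \<Rightarrow> nat \<Rightarrow> nat" where
  "design_rank x n = dim (x ` {1..n})"

text \<open>The matrix M_n, i.e. the transpose of X_n times X_n.\<close>

definition gram :: "(nat \<Rightarrow> real^'p) \<Rightarrow> nat \<Rightarrow> real^'p^'p" where
  "gram x n = (\<chi> i j. \<Sum>k=1..n. x k $ i * x k $ j)"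

text \<open>The transpose of X_n times the vector (y 1, ..., y n).\<close>

definition design_transpose_mult :: "(nat \<Rightarrow> real^'p) \<Rightarrow> (nat \<Rightarrow> real) \<Rightarrow> nat \<Rightarrow> real^'p" where
  "design_transpose_mult x y n = (\<chi> i. \<Sum>k=1..n. x k $ i * y k)"

text \<open>Since \<open>matrix_inv\<close> is unspecified on singular matrices, this is meaningful only if
  \<open>design_rank x n = CARD('p)\<close>.\<close>

definition ols :: "(nat \<Rightarrow> real^'p) \<Rightarrow> (nat \<Rightarrow> real) \<Rightarrow> nat \<Rightarrow> real^'p" where
  "ols x y n = matrix_inv (gram x n) *v design_transpose_mult x y n"

definition diag_scaling :: "(nat \<Rightarrow> real^'p) \<Rightarrow> nat \<Rightarrow> real^'p^'p" where
  "diag_scaling x n = (\<chi> i j. if i = j then sqrt (gram x n $ i $ i) else 0)"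

locale linear_regression = prob_space M
  for M :: "'w measure" +
  fixes \<beta> :: "real^'p"
    and x :: "nat \<Rightarrow> real^'p"
    and \<epsilon> :: "nat \<Rightarrow> 'w \<Rightarrow> real"
    and \<sigma> :: real
    and Y :: "nat \<Rightarrow> 'w \<Rightarrow> real"
  assumes indep_errors: "indep_vars (\<lambda>_. borel) \<epsilon> {1..}"
    and integrable_error: "\<And>i. i \<ge> 1 \<Longrightarrow> integrable M (\<epsilon> i)"
    and mean_error: "\<And>i. i \<ge> 1 \<Longrightarrow> expectation (\<epsilon> i) = 0"
    and square_integrable_error: "\<And>i. i \<ge> 1 \<Longrightarrow> integrable M (\<lambda>\<omega>. (\<epsilon> i \<omega>)\<^sup>2)"
    and variance_error: "\<And>i. i \<ge> 1 \<Longrightarrow> variance (\<epsilon> i) = \<sigma>\<^sup>2"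
    and response: "\<And>i \<omega>. i \<ge> 1 \<Longrightarrow> \<omega> \<in> space M \<Longrightarrow> Y i \<omega> = x i \<bullet> \<beta> + \<epsilon> i \<omega>"

text \<open>Since the diagonal of the Gram matrix diverges, only finitely many n give a division by zero
  or a singular scaling matrix in the last two limits.\<close>

definition diag_normalized_design :: "(nat \<Rightarrow> real^'p) \<Rightarrow> real^'p^'p \<Rightarrow> bool" where
  "diag_normalized_design x V \<longleftrightarrow>
     (\<forall>i. filterlim (\<lambda>n. gram x n $ i $ i) at_top sequentially) \<and>
     (\<forall>i. (\<lambda>n. (x (n + 1) $ i)\<^sup>2 / gram x n $ i $ i) \<longlonglongrightarrow> 0) \<and>
     invertible V \<and>
     (\<lambda>n. matrix_inv (diag_scaling x n) ** gram x n ** matrix_inv (diag_scaling x n))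
        \<longlonglongrightarrow> matrix_inv V"

definition sqrt_normalized_design :: "(nat \<Rightarrow> real^'p) \<Rightarrow> real^'p^'p \<Rightarrow> bool" where
  "sqrt_normalized_design x V \<longleftrightarrow>
     invertible V \<and> (\<lambda>n. (1 / real n) *\<^sub>R gram x n) \<longlonglongrightarrow> matrix_inv V"

text \<open>Integrals with respect to dF_i are integrals with respect to the law of \<open>\<epsilon> i\<close>.\<close>

definition error_tail_condition :: "'w measure \<Rightarrow> (nat \<Rightarrow> 'w \<Rightarrow> real) \<Rightarrow> bool" where
  "error_tail_condition M \<epsilon> \<longleftrightarrow>
     ((\<lambda>c::real. SUP i\<in>{1..}.
         \<integral>\<^sup>+u. ennreal (u\<^sup>2) * indicator {u. c < \<bar>u\<bar>} u \<partial>distr M borel (\<epsilon> i)) \<longlongrightarrow> 0) at_top"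

definition LM :: "real \<Rightarrow> 'w measure \<Rightarrow> real^'p \<Rightarrow> (nat \<Rightarrow> real^'p) \<Rightarrow> (nat \<Rightarrow> 'w \<Rightarrow> real) \<Rightarrow> real
    \<Rightarrow> (nat \<Rightarrow> 'w \<Rightarrow> real) \<Rightarrow> bool" where
  "LM R M \<beta> x \<epsilon> \<sigma> Y \<longleftrightarrow>
     linear_regression M \<beta> x \<epsilon> \<sigma> Y \<and>
     ((\<exists>V. diag_normalized_design x V) \<and> error_tail_condition M \<epsilon> \<or>
      (\<exists>V. sqrt_normalized_design x V) \<and> error_tail_condition M \<epsilon>) \<and>
     (SUP i\<in>{1..}. \<integral>\<^sup>+\<omega>. ennreal (\<bar>\<epsilon> i \<omega>\<bar> powr R) \<partial>M) < \<infinity>"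

definition admissible_normalization :: "'w measure \<Rightarrow> (nat \<Rightarrow> real^'p) \<Rightarrow> (nat \<Rightarrow> 'w \<Rightarrow> real)
    \<Rightarrow> (nat \<Rightarrow> real^'p^'p) \<Rightarrow> real^'p^'p \<Rightarrow> bool" where
  "admissible_normalization M x \<epsilon> \<Gamma> V \<longleftrightarrow>
     diag_normalized_design x V \<and> error_tail_condition M \<epsilon> \<and> \<Gamma> = diag_scaling x \<or>
     sqrt_normalized_design x V \<and> error_tail_condition M \<epsilon> \<and> \<Gamma> = (\<lambda>n. sqrt (real n) *\<^sub>R mat 1)"

definition uniformly_integrable :: "'w measure \<Rightarrow> 'i set \<Rightarrow> ('i \<Rightarrow> 'w \<Rightarrow> real) \<Rightarrow> bool" where
  "uniformly_integrable M I f \<longleftrightarrow>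
     (\<forall>i\<in>I. f i \<in> borel_measurable M) \<and>
     ((\<lambda>c::real. SUP i\<in>I. \<integral>\<^sup>+\<omega>. ennreal \<bar>f i \<omega>\<bar> * indicator {\<omega>. c < \<bar>f i \<omega>\<bar>} \<omega> \<partial>M)
        \<longlongrightarrow> 0) at_top"

text \<open>The law N(m, v) with mean m and variance v (at least 0), where v = 0 gives a point mass;
  \<open>normal_density\<close> takes the standard deviation and does not cover that case.\<close>

definition normal_law :: "real \<Rightarrow> real \<Rightarrow> real measure" where
  "normal_law m v =
     (if v = 0 then return borel m else density lborel (\<lambda>t. ennreal (normal_density m (sqrt v) t)))"

end

(*
  Let D be the diagonal normalization and let w_n solve (D_n^-1 M_n D_n^-1) w_n = alpha, so that
  w_n -> V alpha by Cramer's rule.  Then xi_n is the sum over k <= n of a_nk eps_k with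
  a_nk = w_n^T D_n^-1 x_k, where the squares of the a_nk sum to alpha^T w_n -> alpha^T V alpha and
  max_k |a_nk| -> 0.  The uniform tail condition then makes the characteristic functions converge
  as in Lindeberg's theorem.  For the moments, the pointwise bound
  |x + y|^R <= |x|^R + R sgn(x) |x|^(R-1) y + C ((1 + |x|^R) y^2 + |y|^R)
  has a linear term of mean 0 under independence, so 1 + E|S|^R gains at most the factor
  1 + C (E y^2 + E|y|^R) per summand y; this bounds E|xi_n|^R.  A bounded R-th moment gives uniform
  integrability of |xi_n|^r for r < R, hence convergence of moments along the weak limit.
*)
theory Submission
  imports Defs
begin

text \<open>Since \<open>R\<close> need not be an even integer, E|S|^R has no expansion into mixed
  moments, and centering can be exploited only through a pointwise inequality that is exact to first
  order in the new summand. Its remainder carries 1 + |x|^R, so that the tracked quantity reproduces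
  itself from step to step. The condition R >= 2 is used twice: for a second-order remainder, and
  for |a_nk|^R <= a_nk^2 once |a_nk| <= 1, which reduces everything to the convergent sum of
  squares.

  Both normalizations are diagonal with nondecreasing entries that diverge, so one argument serves
  both; in the sqrt(n) case the negligibility of single rows follows from the convergence of the
  averaged Gram matrices.

  The limits run through all n, but finitely many Gram matrices may be singular. One bound on
  E|xi_n|^R must cover these n too; it exists because the estimator is linear in the responses
  whatever the matrix inverse is there.\<close>

section \<open>Moments of sums of independent random variables\<close>

lemma powr_abs_le_one_plus:
  fixes x :: real
  assumes "0 < q" "q \<le> R"
  shows "\<bar>x\<bar> powr q \<le> 1 + \<bar>x\<bar> powr R"
proof (cases "\<bar>x\<bar> \<le> 1")
  case True
  then have "\<bar>x\<bar> powr q \<le> 1 powr q" using assms by (intro powr_mono2) auto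
  then show ?thesis by (simp add: add_increasing2)
next
  case False
  then have "\<bar>x\<bar> powr q \<le> \<bar>x\<bar> powr R" using assms by (intro powr_mono) auto
  then show ?thesis by simp
qed

lemma powr_abs_add_le:
  fixes x y :: real
  assumes "0 < R"
  shows "\<bar>x + y\<bar> powr R \<le> 2 powr R * (\<bar>x\<bar> powr R + \<bar>y\<bar> powr R)"
proof -
  have "\<bar>x + y\<bar> powr R \<le> (2 * max \<bar>x\<bar> \<bar>y\<bar>) powr R"
    using assms by (intro powr_mono2) auto
  also have "\<dots> = 2 powr R * max \<bar>x\<bar> \<bar>y\<bar> powr R"
    by (subst powr_mult) auto
  also have "\<dots> \<le> 2 powr R * (\<bar>x\<bar> powr R + \<bar>y\<bar> powr R)"
    by (auto simp: max_def)
  finally show ?thesis .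
qed

text \<open>The segment from x to x + y stays inside [x/2, 2x], away from the singularity of
  \<open>powr\<close> at 0, so Taylor's formula with Lagrange remainder applies. There t^(R-2) <=
  (2x)^(R-2), and x^(R-2) <= 1 + x^R produces the factor that the moment recursion can
  absorb.\<close>

lemma powr_Taylor_near:
  fixes x y R :: real
  assumes R: "R \<ge> 2" and x: "x > 0" and y: "\<bar>y\<bar> \<le> x / 2"
  shows "(x + y) powr R \<le> x powr R + R * x powr (R - 1) * y
           + R * (R - 1) * 2 powr (R - 2) * ((1 + x powr R) * y\<^sup>2)"
proof (cases "y = 0")
  case False
  define D where "D = (\<lambda>m t. if m = 0 then t powr R else if m = Suc 0 then R * t powr (R - 1)
    else R * ((R - 1) * t powr (R - 2)) :: real)"
  \<comment> \<open>\<open>D 0\<close>, \<open>D 1\<close>, \<open>D 2\<close> are t^R and its first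
    two derivatives. The formula requires an evaluation point different from x, hence the separate
    case y = 0.\<close>
  have "\<exists>t. (if x + y < x then x + y < t \<and> t < x else x < t \<and> t < x + y) \<and>
      (x + y) powr R = (\<Sum>m<2. D m x / fact m * (x + y - x) ^ m) + D 2 t / fact 2 * (x + y - x) ^ 2"
  proof (rule Taylor[where a = "x / 2" and b = "2 * x"])
    show "\<forall>m t. m < 2 \<and> x / 2 \<le> t \<and> t \<le> 2 * x \<longrightarrow> DERIV (D m) t :> D (Suc m) t"
    proof (intro allI impI)
      fix m :: nat and t :: real
      assume a: "m < 2 \<and> x / 2 \<le> t \<and> t \<le> 2 * x"
      then have t: "t > 0" using x by linarith
      consider "m = 0" | "m = 1" using a by linarith
      then show "DERIV (D m) t :> D (Suc m) t"
      proof cases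
        case 1
        then show ?thesis using t by (auto simp: D_def intro!: derivative_eq_intros)
      next
        case 2
        have "R - 1 - 1 = R - 2" by simp
        with 2 show ?thesis using t
          by (auto simp: D_def intro!: derivative_eq_intros)
      qed
    qed
  qed (use x y False in \<open>auto simp: D_def\<close>)
  then obtain t where t: "if x + y < x then x + y < t \<and> t < x else x < t \<and> t < x + y"
    and eq: "(x + y) powr R = (\<Sum>m<2. D m x / fact m * (x + y - x) ^ m) + D 2 t / fact 2 * (x + y - x) ^ 2"
    by blast
  have t': "0 < t" "t \<le> 2 * x" using t x y by (auto split: if_splits)
  have "x powr (R - 2) \<le> 1 + x powr R"
  proof (cases "R = 2")
    case False
    then show ?thesis using powr_abs_le_one_plus[of "R - 2" R x] R x by simp
  qed (use x in simp)
  moreover have "t powr (R - 2) \<le> (2 * x) powr (R - 2)"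
    using t' R by (intro powr_mono2) auto
  ultimately have "t powr (R - 2) \<le> 2 powr (R - 2) * (1 + x powr R)"
    using x by (simp add: powr_mult) (smt (verit) mult_left_mono powr_ge_zero)
  then have "R * (R - 1) * y\<^sup>2 * t powr (R - 2) \<le> R * (R - 1) * y\<^sup>2 * (2 powr (R - 2) * (1 + x powr R))"
    using R by (intro mult_left_mono) auto
  moreover have "(x + y) powr R = x powr R + R * x powr (R - 1) * y + R * (R - 1) * y\<^sup>2 * t powr (R - 2) / 2"
    unfolding eq by (simp add: D_def numeral_2_eq_2)
  moreover have "0 \<le> R * (R - 1) * y\<^sup>2 * t powr (R - 2)"
    using R by simp
  ultimately have "(x + y) powr R \<le> x powr R + R * x powr (R - 1) * y
      + R * (R - 1) * y\<^sup>2 * (2 powr (R - 2) * (1 + x powr R))"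
    by linarith
  then show ?thesis by (simp only: ac_simps)
qed simp

text \<open>Here y dominates: |x + y| <= 3|y| and x < 2|y|. The linear term may be as low as -R
  (2|y|)^(R-1) |y|; the summand R 2^(R-1) in the constant pays for that.\<close>

lemma powr_Taylor_far:
  fixes x y R :: real
  assumes R: "R \<ge> 2" and x: "x > 0" and y: "\<bar>y\<bar> > x / 2"
  shows "\<bar>x + y\<bar> powr R \<le> x powr R + R * x powr (R - 1) * y
           + (3 powr R + R * 2 powr (R - 1)) * \<bar>y\<bar> powr R"
proof -
  have "\<bar>x + y\<bar> powr R \<le> (3 * \<bar>y\<bar>) powr R"
    using R y x by (intro powr_mono2) auto
  then have 1: "\<bar>x + y\<bar> powr R \<le> 3 powr R * \<bar>y\<bar> powr R"
    by (simp add: powr_mult)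
  have "x powr (R - 1) \<le> (2 * \<bar>y\<bar>) powr (R - 1)"
    using R y x by (intro powr_mono2) auto
  then have "R * x powr (R - 1) * \<bar>y\<bar> \<le> R * (2 powr (R - 1) * \<bar>y\<bar> powr (R - 1)) * \<bar>y\<bar>"
    using R by (intro mult_right_mono mult_left_mono) (auto simp: powr_mult)
  also have "\<dots> = R * 2 powr (R - 1) * (\<bar>y\<bar> powr (R - 1) * \<bar>y\<bar> powr 1)"
    by simp
  also have "\<bar>y\<bar> powr (R - 1) * \<bar>y\<bar> powr 1 = \<bar>y\<bar> powr R"
    by (subst powr_add[symmetric]) simp
  finally have "R * x powr (R - 1) * \<bar>y\<bar> \<le> R * 2 powr (R - 1) * \<bar>y\<bar> powr R" .
  moreover have "- (R * x powr (R - 1) * \<bar>y\<bar>) \<le> R * x powr (R - 1) * y"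
    using R x by (simp add: abs_if)
  ultimately show ?thesis using 1 powr_ge_zero[of x R] unfolding distrib_right by linarith
qed

text \<open>Negating x and y together reduces negative x to positive x, where the near and the far
  bound apply with constants A and B. The summand 1 makes C >= 1, which is what x = 0
  requires.\<close>

lemma powr_abs_Taylor_bound:
  fixes R :: real
  assumes R: "R \<ge> 2"
  obtains C where "C > 0" "\<And>x y :: real. \<bar>x + y\<bar> powr R
      \<le> \<bar>x\<bar> powr R + R * (sgn x * \<bar>x\<bar> powr (R - 1)) * y + C * ((1 + \<bar>x\<bar> powr R) * y\<^sup>2 + \<bar>y\<bar> powr R)"
proof -
  define A B C where "A = R * (R - 1) * 2 powr (R - 2)" and "B = 3 powr R + R * 2 powr (R - 1)"
    and "C = A + B + 1"
  have AB: "A \<ge> 0" "B \<ge> 0" using R by (auto simp: A_def B_def)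
  have pos: "\<bar>x + y\<bar> powr R \<le> \<bar>x\<bar> powr R + R * (sgn x * \<bar>x\<bar> powr (R - 1)) * y
      + C * ((1 + \<bar>x\<bar> powr R) * y\<^sup>2 + \<bar>y\<bar> powr R)" if x: "x > 0" for x y :: real
  proof -
    let ?U = "(1 + x powr R) * y\<^sup>2" and ?W = "\<bar>y\<bar> powr R"
    have nn: "?U \<ge> 0" "?W \<ge> 0" by auto
    have "A * ?U \<le> C * (?U + ?W)" "B * ?W \<le> C * (?U + ?W)"
      using AB nn by (auto simp: C_def intro!: mult_mono)
    then show ?thesis
      using powr_Taylor_near[OF R x, of y] powr_Taylor_far[OF R x, of y] x
      by (cases "\<bar>y\<bar> \<le> x / 2") (auto simp: A_def B_def)
  qed
  have "\<bar>x + y\<bar> powr R \<le> \<bar>x\<bar> powr R + R * (sgn x * \<bar>x\<bar> powr (R - 1)) * y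
      + C * ((1 + \<bar>x\<bar> powr R) * y\<^sup>2 + \<bar>y\<bar> powr R)" for x y :: real
  proof -
    consider "x > 0" | "x = 0" | "- x > 0" by linarith
    then show ?thesis
    proof cases
      case 2
      have "1 * \<bar>y\<bar> powr R \<le> C * (y\<^sup>2 + \<bar>y\<bar> powr R)"
        using AB by (intro mult_mono) (auto simp: C_def)
      then show ?thesis using 2 by simp
    next
      case 3
      have "\<bar>- x - y\<bar> = \<bar>x + y\<bar>" by linarith
      then show ?thesis using pos[OF 3, of "- y"] by (simp add: sgn_minus)
    qed (rule pos)
  qed
  moreover have "C > 0" using AB by (simp add: C_def)
  ultimately show thesis using that by blast
qed

section \<open>From the pointwise inequality to moment bounds\<close>

context prob_space
begin

lemma integrable_powr_abs_add:
  fixes f g :: "'a \<Rightarrow> real"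
  assumes "0 < R" "f \<in> borel_measurable M" "g \<in> borel_measurable M"
    and "integrable M (\<lambda>\<omega>. \<bar>f \<omega>\<bar> powr R)" "integrable M (\<lambda>\<omega>. \<bar>g \<omega>\<bar> powr R)"
  shows "integrable M (\<lambda>\<omega>. \<bar>f \<omega> + g \<omega>\<bar> powr R)"
proof (rule Bochner_Integration.integrable_bound)
  show "integrable M (\<lambda>\<omega>. 2 powr R * (\<bar>f \<omega>\<bar> powr R + \<bar>g \<omega>\<bar> powr R))"
    using assms by auto
qed (use assms in \<open>auto intro!: AE_I2 powr_abs_add_le\<close>)

lemma integrable_powr_abs_sum:
  fixes X :: "'i \<Rightarrow> 'a \<Rightarrow> real"
  assumes "0 < R" "finite F" "\<And>i. i \<in> F \<Longrightarrow> X i \<in> borel_measurable M"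
    and "\<And>i. i \<in> F \<Longrightarrow> integrable M (\<lambda>\<omega>. \<bar>X i \<omega>\<bar> powr R)"
  shows "integrable M (\<lambda>\<omega>. \<bar>\<Sum>i\<in>F. X i \<omega>\<bar> powr R)"
  using assms(2-)
proof (induction F)
  case (insert i F)
  then show ?case using assms(1) by (auto intro!: integrable_powr_abs_add)
qed simp

lemma integrable_powr_abs_mono:
  fixes f :: "'a \<Rightarrow> real"
  assumes "0 < q" "q \<le> R" "f \<in> borel_measurable M" "integrable M (\<lambda>\<omega>. \<bar>f \<omega>\<bar> powr R)"
  shows "integrable M (\<lambda>\<omega>. \<bar>f \<omega>\<bar> powr q)"
proof (rule Bochner_Integration.integrable_bound)
  show "integrable M (\<lambda>\<omega>. 1 + \<bar>f \<omega>\<bar> powr R)"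
    using assms by auto
qed (use assms in \<open>auto intro!: AE_I2 powr_abs_le_one_plus order_trans[OF _ abs_ge_self]\<close>)

text \<open>Insert x = S, y = X and integrate. The linear term is a product of independent factors,
  one of them centered, and vanishes; in the quadratic term E(1 + |S|^R) and E X^2 separate.\<close>

lemma moment_sum_indep_step:
  fixes S X :: "'a \<Rightarrow> real"
  assumes R: "R \<ge> 2" and C: "C > 0" "\<And>x y :: real. \<bar>x + y\<bar> powr R
      \<le> \<bar>x\<bar> powr R + R * (sgn x * \<bar>x\<bar> powr (R - 1)) * y + C * ((1 + \<bar>x\<bar> powr R) * y\<^sup>2 + \<bar>y\<bar> powr R)"
    and ind: "indep_var borel X borel S"
    and S: "integrable M (\<lambda>\<omega>. \<bar>S \<omega>\<bar> powr R)"
    and X: "integrable M X" "expectation X = 0" "integrable M (\<lambda>\<omega>. (X \<omega>)\<^sup>2)"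
      "integrable M (\<lambda>\<omega>. \<bar>X \<omega>\<bar> powr R)"
  shows "1 + expectation (\<lambda>\<omega>. \<bar>S \<omega> + X \<omega>\<bar> powr R) \<le> (1 + expectation (\<lambda>\<omega>. \<bar>S \<omega>\<bar> powr R))
      * (1 + C * (expectation (\<lambda>\<omega>. (X \<omega>)\<^sup>2) + expectation (\<lambda>\<omega>. \<bar>X \<omega>\<bar> powr R)))"
proof -
  let ?G = "\<lambda>x. R * (sgn x * \<bar>x\<bar> powr (R - 1))" and ?H = "\<lambda>x. 1 + \<bar>x\<bar> powr R"
  note [measurable] = indep_var_rv1[OF ind] indep_var_rv2[OF ind]
  have iG: "integrable M (\<lambda>\<omega>. ?G (S \<omega>))"
  proof (rule Bochner_Integration.integrable_bound)
    show "integrable M (\<lambda>\<omega>. R * \<bar>S \<omega>\<bar> powr (R - 1))"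
      using R S by (intro integrable_mult_right) (rule integrable_powr_abs_mono[of _ R], auto)
  qed (use R in \<open>auto intro!: AE_I2 simp: abs_mult sgn_real_def\<close>)
  have indG: "indep_var borel X borel (\<lambda>\<omega>. ?G (S \<omega>))"
    using indep_var_compose[OF ind, of "\<lambda>x. x" borel ?G borel] by (simp add: o_def)
  have indH: "indep_var borel (\<lambda>\<omega>. (X \<omega>)\<^sup>2) borel (\<lambda>\<omega>. ?H (S \<omega>))"
    using indep_var_compose[OF ind, of "\<lambda>x. x\<^sup>2" borel ?H borel] by (simp add: o_def)
  have iH: "integrable M (\<lambda>\<omega>. ?H (S \<omega>))" using S by auto
  have 1: "integrable M (\<lambda>\<omega>. ?G (S \<omega>) * X \<omega>)" "expectation (\<lambda>\<omega>. ?G (S \<omega>) * X \<omega>) = 0"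
    using indep_var_integrable[OF indG X(1) iG] indep_var_lebesgue_integral[OF indG X(1) iG] X(2)
    by (auto simp: mult.commute[of _ "X _"])
  have 2: "integrable M (\<lambda>\<omega>. ?H (S \<omega>) * (X \<omega>)\<^sup>2)"
    "expectation (\<lambda>\<omega>. ?H (S \<omega>) * (X \<omega>)\<^sup>2) = expectation (\<lambda>\<omega>. ?H (S \<omega>)) * expectation (\<lambda>\<omega>. (X \<omega>)\<^sup>2)"
    using indep_var_integrable[OF indH X(3) iH] indep_var_lebesgue_integral[OF indH X(3) iH]
    by (simp_all only: mult.commute)
  define s p q where "s = expectation (\<lambda>\<omega>. \<bar>S \<omega>\<bar> powr R)" and "p = expectation (\<lambda>\<omega>. (X \<omega>)\<^sup>2)"
    and "q = expectation (\<lambda>\<omega>. \<bar>X \<omega>\<bar> powr R)"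
  have nn: "s \<ge> 0" "p \<ge> 0" "q \<ge> 0" by (auto simp: s_def p_def q_def)
  have "expectation (\<lambda>\<omega>. \<bar>S \<omega> + X \<omega>\<bar> powr R) \<le> expectation (\<lambda>\<omega>. \<bar>S \<omega>\<bar> powr R + ?G (S \<omega>) * X \<omega>
      + C * (?H (S \<omega>) * (X \<omega>)\<^sup>2 + \<bar>X \<omega>\<bar> powr R))"
  proof (rule integral_mono)
    show "integrable M (\<lambda>\<omega>. \<bar>S \<omega> + X \<omega>\<bar> powr R)"
      using R S X by (intro integrable_powr_abs_add) auto
    show "integrable M (\<lambda>\<omega>. \<bar>S \<omega>\<bar> powr R + ?G (S \<omega>) * X \<omega> + C * (?H (S \<omega>) * (X \<omega>)\<^sup>2 + \<bar>X \<omega>\<bar> powr R))"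
      using S 1(1) 2(1) X(4) by (intro Bochner_Integration.integrable_add integrable_mult_right) auto
  qed (rule C)
  also have "\<dots> = expectation (\<lambda>\<omega>. \<bar>S \<omega>\<bar> powr R) + expectation (\<lambda>\<omega>. ?G (S \<omega>) * X \<omega>)
      + C * (expectation (\<lambda>\<omega>. ?H (S \<omega>) * (X \<omega>)\<^sup>2) + expectation (\<lambda>\<omega>. \<bar>X \<omega>\<bar> powr R))"
    using S 1(1) 2(1) X(4)
    by (subst Bochner_Integration.integral_add Bochner_Integration.integral_mult_right
        | intro Bochner_Integration.integrable_add integrable_mult_right | simp)+
  also have "expectation (\<lambda>\<omega>. ?H (S \<omega>)) = 1 + s"
    using S by (simp add: s_def prob_space)
  then have "expectation (\<lambda>\<omega>. \<bar>S \<omega>\<bar> powr R) + expectation (\<lambda>\<omega>. ?G (S \<omega>) * X \<omega>)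
      + C * (expectation (\<lambda>\<omega>. ?H (S \<omega>) * (X \<omega>)\<^sup>2) + expectation (\<lambda>\<omega>. \<bar>X \<omega>\<bar> powr R))
      = s + C * ((1 + s) * p + q)"
    unfolding 1(2) 2(2) by (simp add: s_def p_def q_def)
  finally have "expectation (\<lambda>\<omega>. \<bar>S \<omega> + X \<omega>\<bar> powr R) \<le> s + C * ((1 + s) * p + q)" .
  \<comment> \<open>Adding 1 and the cross term C s q turns s + C ((1 + s) p + q) into the product
    (1 + s) (1 + C (p + q)).\<close>
  moreover have "0 \<le> C * (s * q)" using nn C(1) by simp
  ultimately show ?thesis unfolding s_def[symmetric] p_def[symmetric] q_def[symmetric]
    by (simp add: algebra_simps)
qed

text \<open>Each summand contributes a factor 1 + u <= exp u, and the factors combine to the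
  exponential of a sum. The number of summands enters only through that sum, as triangular arrays
  require. The empty family gives equality, since 0 \<open>powr\<close> R = 0.\<close>

lemma moment_sum_indep_bound:
  fixes X :: "'i \<Rightarrow> 'a \<Rightarrow> real"
  assumes R: "R \<ge> 2" and C: "C > 0" "\<And>x y :: real. \<bar>x + y\<bar> powr R
      \<le> \<bar>x\<bar> powr R + R * (sgn x * \<bar>x\<bar> powr (R - 1)) * y + C * ((1 + \<bar>x\<bar> powr R) * y\<^sup>2 + \<bar>y\<bar> powr R)"
    and "finite F" and "indep_vars (\<lambda>_. borel) X F"
    and "\<And>i. i \<in> F \<Longrightarrow> integrable M (X i)" and "\<And>i. i \<in> F \<Longrightarrow> expectation (X i) = 0"
    and "\<And>i. i \<in> F \<Longrightarrow> integrable M (\<lambda>\<omega>. (X i \<omega>)\<^sup>2)"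
    and "\<And>i. i \<in> F \<Longrightarrow> integrable M (\<lambda>\<omega>. \<bar>X i \<omega>\<bar> powr R)"
  shows "1 + expectation (\<lambda>\<omega>. \<bar>\<Sum>i\<in>F. X i \<omega>\<bar> powr R)
      \<le> exp (C * (\<Sum>i\<in>F. expectation (\<lambda>\<omega>. (X i \<omega>)\<^sup>2) + expectation (\<lambda>\<omega>. \<bar>X i \<omega>\<bar> powr R)))"
  using assms(4-)
proof (induction F)
  case (insert i F)
  let ?S = "\<lambda>\<omega>. \<Sum>i\<in>F. X i \<omega>"
  let ?e = "\<lambda>i. expectation (\<lambda>\<omega>. (X i \<omega>)\<^sup>2) + expectation (\<lambda>\<omega>. \<bar>X i \<omega>\<bar> powr R)"
  have rv: "j \<in> F \<Longrightarrow> X j \<in> borel_measurable M" for j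
    using insert.prems(1) by (auto simp: indep_vars_def)
  have "1 + expectation (\<lambda>\<omega>. \<bar>\<Sum>i\<in>insert i F. X i \<omega>\<bar> powr R)
      = 1 + expectation (\<lambda>\<omega>. \<bar>?S \<omega> + X i \<omega>\<bar> powr R)"
    using insert.hyps by (simp add: add.commute)
  also have "\<dots> \<le> (1 + expectation (\<lambda>\<omega>. \<bar>?S \<omega>\<bar> powr R)) * (1 + C * ?e i)"
  proof (rule moment_sum_indep_step[OF R C])
    show "indep_var borel (X i) borel ?S"
      using insert by (intro indep_vars_sum) auto
    show "integrable M (\<lambda>\<omega>. \<bar>?S \<omega>\<bar> powr R)"
      using insert R rv by (intro integrable_powr_abs_sum) auto
  qed (use insert in auto)
  also have "\<dots> \<le> exp (C * (\<Sum>i\<in>F. ?e i)) * exp (C * ?e i)"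
  proof (rule mult_mono)
    show "1 + expectation (\<lambda>\<omega>. \<bar>?S \<omega>\<bar> powr R) \<le> exp (C * (\<Sum>i\<in>F. ?e i))"
      using insert indep_vars_subset[OF insert.prems(1), of F] by auto
    show "0 \<le> 1 + C * ?e i"
      using C(1) by (auto intro!: add_nonneg_nonneg mult_nonneg_nonneg)
  qed (auto simp: exp_ge_add_one_self)
  also have "\<dots> = exp (C * (\<Sum>i\<in>insert i F. ?e i))"
    using insert.hyps by (simp add: exp_add[symmetric] distrib_left)
  finally show ?case .
qed simp

end

section \<open>The limit law of weighted sums\<close>

text \<open>Both directions come from exp t >= 1 + t: directly at t = -u, and at t = u through exp
  (-u) <= 1/(1 + u) <= 1 - u + u^2.\<close>

lemma exp_minus_first_order_bound:
  fixes u :: real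
  assumes "u \<ge> 0"
  shows "\<bar>1 - u - exp (- u)\<bar> \<le> u\<^sup>2"
proof -
  have "exp (- u) \<le> 1 / (1 + u)"
    using assms exp_ge_add_one_self[of u] by (simp add: exp_minus field_simps)
  also have "1 / (1 + u) \<le> 1 - u + u\<^sup>2"
    using assms by (simp add: divide_le_eq) (simp add: algebra_simps power2_eq_square)
  finally have "exp (- u) \<le> 1 - u + u\<^sup>2" .
  moreover have "1 - u \<le> exp (- u)" using exp_ge_add_one_self[of "- u"] by simp
  ultimately show ?thesis by linarith
qed

context prob_space
begin

lemma char_distr_cmult:
  fixes X :: "'a \<Rightarrow> real"
  assumes [measurable]: "X \<in> borel_measurable M"
  shows "char (distr M borel (\<lambda>\<omega>. a * X \<omega>)) t = char (distr M borel X) (t * a)"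
  by (simp add: char_def integral_distr mult.assoc)

text \<open>Both numbers are compared with 1 - s^2 v / 2. For the characteristic function the Taylor
  remainder min (6 X^2) (|s| |X|^3) is split at |X| = c, with the cubic bound below and the
  quadratic one above. The prefactor s^2 is kept so that summing over s = t a_nk gives t^2 times the
  sum of squares.\<close>

lemma char_exp_distance:
  fixes X :: "'a \<Rightarrow> real"
  assumes [measurable]: "X \<in> borel_measurable M"
    and X: "integrable M X" "integrable M (\<lambda>\<omega>. (X \<omega>)\<^sup>2)" "expectation X = 0" "variance X = v"
    and tail: "expectation (\<lambda>\<omega>. (X \<omega>)\<^sup>2 * indicator {\<omega>. c < \<bar>X \<omega>\<bar>} \<omega>) \<le> e"
    and c: "c \<ge> 0"
  shows "cmod (char (distr M borel X) s - exp (- (s\<^sup>2 * v / 2))) \<le> s\<^sup>2 * (\<bar>s\<bar> * c * v + e + s\<^sup>2 * v\<^sup>2)"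
proof -
  have v: "v = expectation (\<lambda>\<omega>. (X \<omega>)\<^sup>2)" "v \<ge> 0"
    using X(3,4) by auto
  have iT: "integrable M (\<lambda>\<omega>. (X \<omega>)\<^sup>2 * indicator {\<omega>. c < \<bar>X \<omega>\<bar>} \<omega>)"
    by (rule Bochner_Integration.integrable_bound[OF X(2)]) (auto intro!: AE_I2 simp: indicator_def)
  have pw: "min (6 * (X \<omega>)\<^sup>2) (\<bar>s\<bar> * \<bar>X \<omega>\<bar>^3)
      \<le> \<bar>s\<bar> * c * (X \<omega>)\<^sup>2 + 6 * ((X \<omega>)\<^sup>2 * indicator {\<omega>. c < \<bar>X \<omega>\<bar>} \<omega>)" for \<omega>
  proof (cases "c < \<bar>X \<omega>\<bar>")
    case True
    then show ?thesis using c by (auto simp: min_def intro: add_increasing)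
  next
    case False
    then have "\<bar>s\<bar> * (\<bar>X \<omega>\<bar> * (X \<omega>)\<^sup>2) \<le> \<bar>s\<bar> * (c * (X \<omega>)\<^sup>2)"
      by (intro mult_left_mono mult_right_mono) auto
    then show ?thesis using False by (simp add: power3_eq_cube power2_eq_square abs_mult_self_eq mult.assoc min.coboundedI2)
  qed
  have iR: "integrable M (\<lambda>\<omega>. \<bar>s\<bar> * c * (X \<omega>)\<^sup>2 + 6 * ((X \<omega>)\<^sup>2 * indicator {\<omega>. c < \<bar>X \<omega>\<bar>} \<omega>))"
    using X(2) iT by (intro Bochner_Integration.integrable_add integrable_mult_right)
  have "expectation (\<lambda>\<omega>. min (6 * (X \<omega>)\<^sup>2) (\<bar>s\<bar> * \<bar>X \<omega>\<bar>^3))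
      \<le> expectation (\<lambda>\<omega>. \<bar>s\<bar> * c * (X \<omega>)\<^sup>2 + 6 * ((X \<omega>)\<^sup>2 * indicator {\<omega>. c < \<bar>X \<omega>\<bar>} \<omega>))"
  proof (rule integral_mono[OF _ iR pw])
    show "integrable M (\<lambda>\<omega>. min (6 * (X \<omega>)\<^sup>2) (\<bar>s\<bar> * \<bar>X \<omega>\<bar>^3))"
      by (rule Bochner_Integration.integrable_bound[OF iR])
        (auto intro!: AE_I2 order_trans[OF pw abs_ge_self])
  qed
  also have "\<dots> = \<bar>s\<bar> * c * v + 6 * expectation (\<lambda>\<omega>. (X \<omega>)\<^sup>2 * indicator {\<omega>. c < \<bar>X \<omega>\<bar>} \<omega>)"
    using X(2) iT by (simp add: v(1))
  also have "\<dots> \<le> \<bar>s\<bar> * c * v + 6 * e" using tail by simp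
  finally have E: "expectation (\<lambda>\<omega>. min (6 * (X \<omega>)\<^sup>2) (\<bar>s\<bar> * \<bar>X \<omega>\<bar>^3)) \<le> \<bar>s\<bar> * c * v + 6 * e" .
  have "cmod (char (distr M borel X) s - (1 - s\<^sup>2 * v / 2)) \<le> s\<^sup>2 / 6 * (\<bar>s\<bar> * c * v + 6 * e)"
    using char_approx3'[OF _ X refl, of s]
    by (rule order_trans) (auto intro!: divide_right_mono mult_left_mono E)
  also have "\<dots> \<le> s\<^sup>2 * (\<bar>s\<bar> * c * v + e)"
  proof -
    have "0 \<le> s\<^sup>2 * (\<bar>s\<bar> * c * v)" using c v(2) by simp
    then show ?thesis by (simp add: algebra_simps)
  qed
  finally have 1: "cmod (char (distr M borel X) s - (1 - s\<^sup>2 * v / 2)) \<le> s\<^sup>2 * (\<bar>s\<bar> * c * v + e)" .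
  have "cmod ((1 - s\<^sup>2 * v / 2) - exp (- (s\<^sup>2 * v / 2))) = \<bar>1 - s\<^sup>2 * v / 2 - exp (- (s\<^sup>2 * v / 2))\<bar>"
    by (subst norm_of_real[symmetric, where 'a = complex]) (simp add: exp_of_real[symmetric])
  also have "\<dots> \<le> (s\<^sup>2 * v / 2)\<^sup>2" using v(2) by (intro exp_minus_first_order_bound) simp
  also have "\<dots> = s\<^sup>2 * (s\<^sup>2 * v\<^sup>2) / 4" by (simp add: power2_eq_square)
  also have "\<dots> \<le> s\<^sup>2 * (s\<^sup>2 * v\<^sup>2)" using mult_nonneg_nonneg[of "s\<^sup>2" "s\<^sup>2 * v\<^sup>2"] by simp
  finally show ?thesis using 1 norm_triangle_ineq[of "char (distr M borel X) s - (1 - s\<^sup>2 * v / 2)"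
      "(1 - s\<^sup>2 * v / 2) - exp (- (s\<^sup>2 * v / 2))"]
    by (simp add: algebra_simps)
qed

text \<open>Lindeberg's replacement argument: \<psi> n is the characteristic function of the
  centered normal law with the variance of the sum. Both \<phi> n and \<psi> n are products of
  factors of modulus at most 1, so their distance is at most the sum of the distances of the
  factors.\<close>

lemma char_weighted_sum_limit:
  fixes X :: "nat \<Rightarrow> 'a \<Rightarrow> real" and a :: "nat \<Rightarrow> nat \<Rightarrow> real"
  assumes indep: "indep_vars (\<lambda>_. borel) X {1..}"
    and X: "\<And>i. i \<ge> 1 \<Longrightarrow> integrable M (X i)" "\<And>i. i \<ge> 1 \<Longrightarrow> integrable M (\<lambda>\<omega>. (X i \<omega>)\<^sup>2)"
      "\<And>i. i \<ge> 1 \<Longrightarrow> expectation (X i) = 0" "\<And>i. i \<ge> 1 \<Longrightarrow> variance (X i) = v"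
    and tail: "\<And>e. e > 0 \<Longrightarrow>
      \<exists>c\<ge>0. \<forall>i\<ge>1. expectation (\<lambda>\<omega>. (X i \<omega>)\<^sup>2 * indicator {\<omega>. c < \<bar>X i \<omega>\<bar>} \<omega>) \<le> e"
    and sq: "(\<lambda>n. \<Sum>k=1..n. (a n k)\<^sup>2) \<longlonglongrightarrow> \<tau>"
    and small: "\<And>e. e > 0 \<Longrightarrow> \<forall>\<^sub>F n in sequentially. \<forall>k\<in>{1..n}. \<bar>a n k\<bar> \<le> e"
  shows "(\<lambda>n. char (distr M borel (\<lambda>\<omega>. \<Sum>k=1..n. a n k * X k \<omega>)) t)
    \<longlonglongrightarrow> exp (- (t\<^sup>2 * (v * \<tau>) / 2))"
proof -
  have rv: "i \<ge> 1 \<Longrightarrow> X i \<in> borel_measurable M" for i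
    using indep by (auto simp: indep_vars_def)
  have v: "v \<ge> 0" using X(4)[of 1] by auto
  have \<tau>: "\<tau> \<ge> 0" by (rule tendsto_lowerbound[OF sq]) (auto intro!: always_eventually sum_nonneg)
  define \<phi> where "\<phi> = (\<lambda>n. char (distr M borel (\<lambda>\<omega>. \<Sum>k=1..n. a n k * X k \<omega>)) t)"
  define \<psi> where "\<psi> = (\<lambda>n. complex_of_real (exp (- (t\<^sup>2 * (v * (\<Sum>k=1..n. (a n k)\<^sup>2)) / 2))))"
  have "\<psi> \<longlonglongrightarrow> complex_of_real (exp (- (t\<^sup>2 * (v * \<tau>) / 2)))"
    unfolding \<psi>_def by (intro tendsto_intros sq) auto
  moreover have "(\<lambda>n. \<phi> n - \<psi> n) \<longlonglongrightarrow> 0"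
  proof (rule tendstoI)
    fix e :: real assume e: "e > 0"
    \<comment> \<open>The final estimate is 2 t^2 (\<tau> + 1) \<eta>; the extra 1 in the
      denominator makes it strictly smaller than e and admits t = 0.\<close>
    define \<eta> where "\<eta> = e / (2 * t\<^sup>2 * (\<tau> + 1) + 1)"
    have pos: "2 * t\<^sup>2 * (\<tau> + 1) + 1 > 0" using \<tau> by (intro add_nonneg_pos) auto
    then have \<eta>: "\<eta> > 0" using e by (simp add: \<eta>_def)
    have \<eta>e: "2 * t\<^sup>2 * (\<tau> + 1) * \<eta> < e"
    proof -
      have "(2 * t\<^sup>2 * (\<tau> + 1) + 1) * \<eta> = e" using pos by (simp add: \<eta>_def)
      then show ?thesis using \<eta> by (simp add: distrib_right)
    qed
    obtain c where c: "c \<ge> 0"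
      "\<And>i. i \<ge> 1 \<Longrightarrow> expectation (\<lambda>\<omega>. (X i \<omega>)\<^sup>2 * indicator {\<omega>. c < \<bar>X i \<omega>\<bar>} \<omega>) \<le> \<eta>"
      using tail[OF \<eta>] by auto
    \<comment> \<open>The tail level c depends on \<eta> alone; only afterwards are the weights made
      small. With |s| <= \<delta> <= 1 the terms |s| c v and s^2 v^2 add up to at most \<delta> (c v
      + v^2) <= \<eta>. The 1 keeps q positive when v = 0.\<close>
    define q where "q = c * v + v\<^sup>2 + 1"
    have q: "q > 0" using c(1) v unfolding q_def by (intro add_nonneg_pos) auto
    define \<delta> where "\<delta> = min 1 (\<eta> / q)"
    have \<delta>: "\<delta> > 0" "\<delta> \<le> 1" "\<delta> * q \<le> \<eta>"
      using q \<eta> by (auto simp: \<delta>_def min_def field_simps)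
    have "\<forall>\<^sub>F n in sequentially. \<forall>k\<in>{1..n}. \<bar>a n k\<bar> \<le> \<delta> / (\<bar>t\<bar> + 1)"
      using \<delta> by (intro small) (auto intro!: divide_pos_pos add_nonneg_pos)
    moreover have "\<forall>\<^sub>F n in sequentially. (\<Sum>k=1..n. (a n k)\<^sup>2) < \<tau> + 1"
      by (rule order_tendstoD[OF sq]) simp
    ultimately show "\<forall>\<^sub>F n in sequentially. dist (\<phi> n - \<psi> n) 0 < e"
    proof eventually_elim
      case (elim n)
      define s where "s = (\<lambda>k. t * a n k)"
      have s: "\<bar>s k\<bar> \<le> \<delta>" if "k \<in> {1..n}" for k
      proof -
        have "\<bar>t\<bar> * \<bar>a n k\<bar> \<le> (\<bar>t\<bar> + 1) * (\<delta> / (\<bar>t\<bar> + 1))"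
          using elim that by (intro mult_mono) auto
        then show ?thesis by (simp add: s_def abs_mult add_nonneg_eq_0_iff)
      qed
      have \<phi>: "\<phi> n = (\<Prod>k=1..n. char (distr M borel (X k)) (s k))"
      proof -
        have "indep_vars (\<lambda>_. borel) (\<lambda>k \<omega>. a n k * X k \<omega>) {1..n}"
          using indep_vars_compose2[OF indep_vars_subset[OF indep, of "{1..n}"],
              of "\<lambda>k x. a n k * x" "\<lambda>_. borel"] by auto
        then have "\<phi> n = (\<Prod>k=1..n. char (distr M borel (\<lambda>\<omega>. a n k * X k \<omega>)) t)"
          unfolding \<phi>_def by (rule char_distr_sum)
        also have "\<dots> = (\<Prod>k=1..n. char (distr M borel (X k)) (s k))"
          unfolding s_def by (intro prod.cong refl char_distr_cmult rv) auto
        finally show ?thesis .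
      qed
      have "- (t\<^sup>2 * (v * (\<Sum>k=1..n. (a n k)\<^sup>2)) / 2) = (\<Sum>k=1..n. - ((s k)\<^sup>2 * v / 2))"
        by (simp add: s_def power_mult_distrib sum_negf sum_distrib_left sum_divide_distrib mult_ac)
      then have \<psi>: "\<psi> n = (\<Prod>k=1..n. complex_of_real (exp (- ((s k)\<^sup>2 * v / 2))))"
        unfolding \<psi>_def by (simp add: exp_sum)
      have "cmod (\<phi> n - \<psi> n) \<le> (\<Sum>k=1..n. cmod (char (distr M borel (X k)) (s k) - complex_of_real (exp (- ((s k)\<^sup>2 * v / 2)))))"
        unfolding \<phi> \<psi>
      proof (rule norm_prod_diff)
        fix k assume "k \<in> {1..n}"
        then have "real_distribution (distr M borel (X k))"
          using rv by (intro real_distribution_distr) auto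
        then show "cmod (char (distr M borel (X k)) (s k)) \<le> 1"
          by (rule real_distribution.cmod_char_le_1)
        show "cmod (complex_of_real (exp (- ((s k)\<^sup>2 * v / 2)))) \<le> 1"
          using v by (simp only: norm_of_real) simp
      qed
      also have "\<dots> \<le> (\<Sum>k=1..n. (s k)\<^sup>2 * (2 * \<eta>))"
      proof (rule sum_mono)
        fix k assume k: "k \<in> {1..n}"
        have "cmod (char (distr M borel (X k)) (s k) - complex_of_real (exp (- ((s k)\<^sup>2 * v / 2))))
            \<le> (s k)\<^sup>2 * (\<bar>s k\<bar> * c * v + \<eta> + (s k)\<^sup>2 * v\<^sup>2)"
          using k char_exp_distance[OF rv X c(2,1), of k "s k"] by (simp add: exp_of_real)
        also have "\<dots> \<le> (s k)\<^sup>2 * (2 * \<eta>)"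
        proof (rule mult_left_mono)
          have "\<bar>s k\<bar> * (c * v) \<le> \<delta> * (c * v)"
            using s[OF k] c(1) v by (intro mult_right_mono) auto
          moreover have "(s k)\<^sup>2 \<le> \<delta>"
          proof -
            have "\<bar>s k\<bar> * \<bar>s k\<bar> \<le> \<delta> * 1" using s[OF k] \<delta> by (intro mult_mono) auto
            then show ?thesis by (simp add: power2_eq_square)
          qed
          then have "(s k)\<^sup>2 * v\<^sup>2 \<le> \<delta> * v\<^sup>2" by (intro mult_right_mono) auto
          ultimately show "\<bar>s k\<bar> * c * v + \<eta> + (s k)\<^sup>2 * v\<^sup>2 \<le> 2 * \<eta>"
            using \<delta> by (simp add: q_def algebra_simps)
        qed simp
        finally show "cmod (char (distr M borel (X k)) (s k) - complex_of_real (exp (- ((s k)\<^sup>2 * v / 2))))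
            \<le> (s k)\<^sup>2 * (2 * \<eta>)" .
      qed
      also have "\<dots> = 2 * t\<^sup>2 * (\<Sum>k=1..n. (a n k)\<^sup>2) * \<eta>"
        by (simp add: s_def power_mult_distrib sum_distrib_left sum_distrib_right mult_ac)
      also have "\<dots> \<le> 2 * t\<^sup>2 * (\<tau> + 1) * \<eta>"
        using elim \<eta> by (intro mult_right_mono mult_left_mono) auto
      also note \<eta>e
      finally show ?case by simp
    qed
  qed
  ultimately have "(\<lambda>n. (\<phi> n - \<psi> n) + \<psi> n) \<longlonglongrightarrow> 0 + complex_of_real (exp (- (t\<^sup>2 * (v * \<tau>) / 2)))"
    by (intro tendsto_add)
  then show ?thesis by (simp add: \<phi>_def)
qed

end

text \<open>For v = 0 the point mass has characteristic function 1. For v > 0 the law is the image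
  of the standard normal law under multiplication by sqrt v, so the standard characteristic function
  is evaluated at t sqrt v.\<close>

lemma
  assumes "v \<ge> 0"
  shows real_distribution_normal_law: "real_distribution (normal_law 0 v)"
    and char_normal_law: "char (normal_law 0 v) t = exp (- (t\<^sup>2 * v / 2))"
proof -
  have "real_distribution (normal_law 0 v) \<and> char (normal_law 0 v) t = exp (- (t\<^sup>2 * v / 2))"
  proof (cases "v = 0")
    case True
    then show ?thesis
      by (auto simp: normal_law_def real_distribution_def real_distribution_axioms_def prob_space_return
          char_def integral_return)
  next
    case False
    then have v: "v > 0" using assms by simp
    interpret N: prob_space std_normal_distribution
      by (rule prob_space_normal_density) simp
    have "distr std_normal_distribution lborel (\<lambda>x. x) = std_normal_distribution"
      by (rule distr_id2) simp
    then have "distributed std_normal_distribution lborel (\<lambda>x. x) std_normal_density"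
      by (simp add: distributed_def)
    from N.normal_density_affine[OF this, of "sqrt v" 0] v
    have "distributed std_normal_distribution lborel (\<lambda>x. sqrt v * x) (normal_density 0 (sqrt v))"
      by simp
    then have "distr std_normal_distribution lborel (\<lambda>x. sqrt v * x) = normal_law 0 v"
      using v by (simp add: distributed_def normal_law_def)
    moreover have "distr std_normal_distribution lborel (\<lambda>x. sqrt v * x)
        = distr std_normal_distribution borel (\<lambda>x. sqrt v * x)"
      by (rule distr_cong) auto
    ultimately have eq: "normal_law 0 v = distr std_normal_distribution borel (\<lambda>x. sqrt v * x)"
      by simp
    have "real_distribution (normal_law 0 v)"
      unfolding eq by (rule N.real_distribution_distr) simp
    moreover have "char (normal_law 0 v) t = char (distr std_normal_distribution borel (\<lambda>x. x)) (t * sqrt v)"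
      unfolding eq by (rule N.char_distr_cmult) simp
    moreover have "distr std_normal_distribution borel (\<lambda>x. x) = std_normal_distribution"
      by (rule distr_id2) simp
    ultimately show ?thesis
      using v by (simp add: char_std_normal_distribution power_mult_distrib)
  qed
  then show "real_distribution (normal_law 0 v)" "char (normal_law 0 v) t = exp (- (t\<^sup>2 * v / 2))"
    by auto
qed

section \<open>Convergence of moments\<close>

text \<open>The exponent r - R is negative, so beyond the threshold d the factor |y|^(r-R) is at
  most d^(r-R).\<close>

lemma powr_abs_tail_le:
  fixes y :: real
  assumes "0 < r" "r < R" "0 < d" "d < \<bar>y\<bar>"
  shows "\<bar>y\<bar> powr r \<le> \<bar>y\<bar> powr R * d powr (r - R)"
proof -
  have "\<bar>y\<bar> powr r = \<bar>y\<bar> powr R * \<bar>y\<bar> powr (r - R)"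
    by (subst powr_add[symmetric]) simp
  also have "\<bar>y\<bar> powr (r - R) \<le> d powr (r - R)"
    using assms by (intro powr_mono2') auto
  finally show ?thesis by (simp add: mult_left_mono)
qed

lemma uniformly_integrable_powr:
  fixes f :: "'i \<Rightarrow> 'w \<Rightarrow> real"
  assumes r: "0 < r" "r < R"
    and f: "\<And>i. i \<in> I \<Longrightarrow> f i \<in> borel_measurable M"
    and bound: "\<And>i. i \<in> I \<Longrightarrow> (\<integral>\<^sup>+\<omega>. ennreal (\<bar>f i \<omega>\<bar> powr R) \<partial>M) \<le> ennreal C"
    and C: "C \<ge> 0"
  shows "uniformly_integrable M I (\<lambda>i \<omega>. \<bar>f i \<omega>\<bar> powr r)"
proof -
  let ?T = "\<lambda>c::real. SUP i\<in>I. \<integral>\<^sup>+\<omega>. ennreal \<bar>\<bar>f i \<omega>\<bar> powr r\<bar> * indicator {\<omega>. c < \<bar>\<bar>f i \<omega>\<bar> powr r\<bar>} \<omega> \<partial>M"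
  have "(?T \<longlongrightarrow> 0) at_top"
  proof (rule tendsto_sandwich[where f = "\<lambda>_. 0" and h = "\<lambda>c. ennreal (C * c powr ((r - R) / r))"])
    show "\<forall>\<^sub>F c in at_top. ?T c \<le> ennreal (C * c powr ((r - R) / r))"
    proof (rule eventually_mono[OF eventually_gt_at_top[of 0]], rule SUP_least)
      fix c :: real and i assume c: "0 < c" and i: "i \<in> I"
      note [measurable] = f[OF i]
      \<comment> \<open>Level c for |f|^r is level d for |f|. The resulting factor d^(r-R) =
        c^((r-R)/r) tends to 0 because its exponent is negative.\<close>
      define d where "d = c powr (1 / r)"
      have d: "d > 0" "d powr r = c" "d powr (r - R) = c powr ((r - R) / r)"
        using c r by (auto simp: d_def powr_powr)
      have "(\<integral>\<^sup>+\<omega>. ennreal \<bar>\<bar>f i \<omega>\<bar> powr r\<bar> * indicator {\<omega>. c < \<bar>\<bar>f i \<omega>\<bar> powr r\<bar>} \<omega> \<partial>M)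
          \<le> (\<integral>\<^sup>+\<omega>. ennreal (c powr ((r - R) / r)) * ennreal (\<bar>f i \<omega>\<bar> powr R) \<partial>M)"
      proof (rule nn_integral_mono)
        fix \<omega>
        have "\<bar>f i \<omega>\<bar> powr r \<le> \<bar>f i \<omega>\<bar> powr R * d powr (r - R)" if "c < \<bar>f i \<omega>\<bar> powr r"
        proof (rule powr_abs_tail_le[OF r d(1)], rule ccontr)
          assume "\<not> d < \<bar>f i \<omega>\<bar>"
          then have "\<bar>f i \<omega>\<bar> powr r \<le> d powr r" using r by (intro powr_mono2) auto
          then show False using that d(2) by simp
        qed
        then show "ennreal \<bar>\<bar>f i \<omega>\<bar> powr r\<bar> * indicator {\<omega>. c < \<bar>\<bar>f i \<omega>\<bar> powr r\<bar>} \<omega>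
            \<le> ennreal (c powr ((r - R) / r)) * ennreal (\<bar>f i \<omega>\<bar> powr R)"
          using d(3) by (auto simp: indicator_def ennreal_mult[symmetric] mult.commute intro!: ennreal_leI)
      qed
      also have "\<dots> = ennreal (c powr ((r - R) / r)) * (\<integral>\<^sup>+\<omega>. ennreal (\<bar>f i \<omega>\<bar> powr R) \<partial>M)"
        by (rule nn_integral_cmult) simp
      also have "\<dots> \<le> ennreal (c powr ((r - R) / r)) * ennreal C"
        by (intro mult_left_mono bound i) simp
      also have "\<dots> = ennreal (C * c powr ((r - R) / r))"
        using C by (simp add: ennreal_mult[symmetric] mult.commute)
      finally show "(\<integral>\<^sup>+\<omega>. ennreal \<bar>\<bar>f i \<omega>\<bar> powr r\<bar> * indicator {\<omega>. c < \<bar>\<bar>f i \<omega>\<bar> powr r\<bar>} \<omega> \<partial>M)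
          \<le> ennreal (C * c powr ((r - R) / r))" .
    qed
    have "((\<lambda>c::real. C * c powr ((r - R) / r)) \<longlongrightarrow> C * 0) at_top"
      using r by (intro tendsto_intros tendsto_neg_powr) (auto simp: filterlim_ident divide_neg_pos)
    then show "((\<lambda>c. ennreal (C * c powr ((r - R) / r))) \<longlongrightarrow> 0) at_top"
      using tendsto_ennrealI by fastforce
  qed auto
  moreover have "(\<lambda>\<omega>. \<bar>f i \<omega>\<bar> powr r) \<in> borel_measurable M" if "i \<in> I" for i
    using f[OF that] by simp
  ultimately show ?thesis unfolding uniformly_integrable_def by blast
qed

lemma isCont_powr_abs:
  fixes x R :: real
  assumes "0 < R"
  shows "isCont (\<lambda>x. \<bar>x\<bar> powr R) x"
  unfolding isCont_def using assms
  by (intro tendsto_powr' tendsto_intros) auto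

text \<open>A Fatou property: the truncations of |x|^R at height m are bounded and continuous, so
  each passes its bound to the weak limit, and monotone convergence in m removes the
  truncation.\<close>

lemma weak_conv_moment_bound:
  fixes \<mu> :: "nat \<Rightarrow> real measure"
  assumes \<mu>: "\<And>n. real_distribution (\<mu> n)" and \<nu>: "real_distribution \<nu>" and wc: "weak_conv_m \<mu> \<nu>"
    and R: "0 < R"
    and bound: "\<And>n. (\<integral>\<^sup>+x. ennreal (\<bar>x\<bar> powr R) \<partial>\<mu> n) \<le> ennreal C"
  shows "(\<integral>\<^sup>+x. ennreal (\<bar>x\<bar> powr R) \<partial>\<nu>) \<le> ennreal C"
proof -
  interpret \<mu>: real_distribution "\<mu> n" for n by fact
  interpret \<nu>: real_distribution \<nu> by fact
  let ?g = "\<lambda>(m::nat) x::real. min (\<bar>x\<bar> powr R) (real m)"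
  have intm: "integrable (\<mu> n) (?g m)" "integrable \<nu> (?g m)" for n m
    by (auto intro!: \<mu>.integrable_const_bound[where B = "real m"] \<nu>.integrable_const_bound[where B = "real m"])
  have "(\<integral>\<^sup>+x. ennreal (?g m x) \<partial>\<nu>) \<le> ennreal C" for m
  proof -
    have "(\<lambda>n. integral\<^sup>L (\<mu> n) (?g m)) \<longlonglongrightarrow> integral\<^sup>L \<nu> (?g m)"
      using isCont_powr_abs[OF R] by (intro weak_conv_imp_integral_bdd_continuous_conv[OF \<mu> \<nu> wc, where B = "real m"])
        (auto intro!: continuous_min)
    then have "(\<lambda>n. ennreal (integral\<^sup>L (\<mu> n) (?g m))) \<longlonglongrightarrow> ennreal (integral\<^sup>L \<nu> (?g m))"
      by (rule tendsto_ennrealI)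
    moreover have "ennreal (integral\<^sup>L (\<mu> n) (?g m)) \<le> ennreal C" for n
    proof -
      have "ennreal (integral\<^sup>L (\<mu> n) (?g m)) = (\<integral>\<^sup>+x. ennreal (?g m x) \<partial>\<mu> n)"
        using intm by (intro nn_integral_eq_integral[symmetric]) auto
      also have "\<dots> \<le> (\<integral>\<^sup>+x. ennreal (\<bar>x\<bar> powr R) \<partial>\<mu> n)"
        by (intro nn_integral_mono ennreal_leI) simp
      also note bound
      finally show ?thesis .
    qed
    ultimately have "ennreal (integral\<^sup>L \<nu> (?g m)) \<le> ennreal C"
      by (rule LIMSEQ_le_const2[OF _ exI, OF _ allI, OF _ impI])
    then show ?thesis
      using intm by (subst nn_integral_eq_integral) auto
  qed
  moreover have "(\<lambda>m. \<integral>\<^sup>+x. ennreal (?g m x) \<partial>\<nu>) \<longlonglongrightarrow> (\<integral>\<^sup>+x. ennreal (\<bar>x\<bar> powr R) \<partial>\<nu>)"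
  proof (rule nn_integral_LIMSEQ)
    show "incseq (\<lambda>m x. ennreal (?g m x))"
      by (auto simp: incseq_def le_fun_def intro!: ennreal_leI)
    fix x :: real
    have "\<forall>\<^sub>F m in sequentially. ennreal (?g m x) = ennreal (\<bar>x\<bar> powr R)"
      using eventually_ge_at_top[of "nat \<lceil>\<bar>x\<bar> powr R\<rceil>"]
      by eventually_elim (simp add: min_def nat_ceiling_le_eq)
    then show "(\<lambda>m. ennreal (?g m x)) \<longlonglongrightarrow> ennreal (\<bar>x\<bar> powr R)"
      by (rule tendsto_eventually)
  qed simp
  ultimately show ?thesis by (intro LIMSEQ_le_const2) auto
qed

text \<open>Replacing h by a bounded continuous g costs at most C d^(r-R), uniformly over all laws
  with R-th absolute moment at most C, the limit law included; weak convergence handles g.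
  Dominating h by |x|^r covers both absolute and integer powers.\<close>

lemma weak_conv_moment_convergence:
  fixes \<mu> :: "nat \<Rightarrow> real measure" and h :: "real \<Rightarrow> real"
  assumes \<mu>: "\<And>n. real_distribution (\<mu> n)" and \<nu>: "real_distribution \<nu>" and wc: "weak_conv_m \<mu> \<nu>"
    and r: "0 < r" "r < R" and C: "C \<ge> 0"
    and bound: "\<And>n. (\<integral>\<^sup>+x. ennreal (\<bar>x\<bar> powr R) \<partial>\<mu> n) \<le> ennreal C"
    and h: "\<And>x. isCont h x" "\<And>x. \<bar>h x\<bar> \<le> \<bar>x\<bar> powr r"
  shows "(\<lambda>n. integral\<^sup>L (\<mu> n) h) \<longlonglongrightarrow> integral\<^sup>L \<nu> h"
proof (rule tendstoI)
  fix e :: real assume e: "e > 0"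
  have hm: "h \<in> borel_measurable borel"
    by (intro borel_measurable_continuous_onI continuous_at_imp_continuous_on ballI h)
  have "((\<lambda>d::real. C * d powr (r - R)) \<longlongrightarrow> C * 0) at_top"
    using r by (intro tendsto_intros tendsto_neg_powr) (auto simp: filterlim_ident)
  then have "\<forall>\<^sub>F d in at_top. C * d powr (r - R) < e / 3"
    using e by (intro order_tendstoD) auto
  then obtain d where d: "d > 0" "C * d powr (r - R) < e / 3"
    using eventually_conj[OF eventually_gt_at_top[of "0::real"]]
    by (metis (mono_tags, lifting) eventually_happens trivial_limit_at_top_linorder)
  \<comment> \<open>Clipping the values at height d^r, instead of cutting off the argument at d,
    keeps g continuous; for |x| <= d nothing changes, as |h x| <= d^r there.\<close>
  define g where "g = (\<lambda>x. max (- (d powr r)) (min (d powr r) (h x)))"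
  have g: "\<bar>g x\<bar> \<le> d powr r" for x
    using powr_ge_zero[of d r] unfolding g_def max_def min_def by (auto simp: abs_le_iff)
  have diff: "\<bar>h x - g x\<bar> \<le> \<bar>x\<bar> powr R * d powr (r - R)" for x
  proof (cases "d < \<bar>x\<bar>")
    case True
    have "\<bar>h x - g x\<bar> \<le> \<bar>h x\<bar>"
      using powr_ge_zero[of d r] unfolding g_def by linarith
    also note h(2)
    also note powr_abs_tail_le[OF r d(1) True]
    finally show ?thesis .
  next
    case False
    then have "\<bar>x\<bar> powr r \<le> d powr r" using r by (intro powr_mono2) auto
    then have "\<bar>h x\<bar> \<le> d powr r" using h(2)[of x] by linarith
    then have "g x = h x" by (auto simp: g_def)
    then show ?thesis by simp
  qed
  have approx: "\<bar>integral\<^sup>L \<rho> h - integral\<^sup>L \<rho> g\<bar> < e / 3"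
    if "real_distribution \<rho>" "(\<integral>\<^sup>+x. ennreal (\<bar>x\<bar> powr R) \<partial>\<rho>) \<le> ennreal C" for \<rho>
  proof -
    interpret \<rho>: real_distribution \<rho> by fact
    have [measurable]: "h \<in> borel_measurable \<rho>" using hm by simp
    have [measurable]: "g \<in> borel_measurable \<rho>" unfolding g_def by measurable
    have iR: "integrable \<rho> (\<lambda>x. \<bar>x\<bar> powr R)"
      by (rule integrableI_nonneg) (use that in \<open>auto intro: le_less_trans\<close>)
    have ig: "integrable \<rho> g" using g by (intro \<rho>.integrable_const_bound[where B = "d powr r"]) auto
    have ihg: "integrable \<rho> (\<lambda>x. h x - g x)"
      by (rule Bochner_Integration.integrable_bound[OF integrable_mult_left[OF iR, of "d powr (r - R)"]])
        (auto intro!: AE_I2 simp: diff)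
    have "integrable \<rho> h" using Bochner_Integration.integrable_add[OF ihg ig] by simp
    then have "\<bar>integral\<^sup>L \<rho> h - integral\<^sup>L \<rho> g\<bar> = \<bar>\<integral>x. h x - g x \<partial>\<rho>\<bar>"
      using ig by simp
    also have "\<dots> \<le> (\<integral>x. \<bar>x\<bar> powr R * d powr (r - R) \<partial>\<rho>)"
      using ihg iR diff by (intro order_trans[OF integral_abs_bound] integral_mono) auto
    also have "\<dots> = (\<integral>x. \<bar>x\<bar> powr R \<partial>\<rho>) * d powr (r - R)" by simp
    also have "(\<integral>x. \<bar>x\<bar> powr R \<partial>\<rho>) \<le> C"
      using that(2) nn_integral_eq_integral[OF iR] C by simp
    then have "(\<integral>x. \<bar>x\<bar> powr R \<partial>\<rho>) * d powr (r - R) \<le> C * d powr (r - R)"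
      by (rule mult_right_mono) simp
    also note d(2)
    finally show ?thesis .
  qed
  have "isCont g x" for x
    unfolding g_def by (intro continuous_max continuous_min continuous_const h)
  then have "(\<lambda>n. integral\<^sup>L (\<mu> n) g) \<longlonglongrightarrow> integral\<^sup>L \<nu> g"
    using g by (intro weak_conv_imp_integral_bdd_continuous_conv[OF \<mu> \<nu> wc, where B = "d powr r"]) auto
  then have "\<forall>\<^sub>F n in sequentially. dist (integral\<^sup>L (\<mu> n) g) (integral\<^sup>L \<nu> g) < e / 3"
    using e by (intro tendstoD) auto
  then show "\<forall>\<^sub>F n in sequentially. dist (integral\<^sup>L (\<mu> n) h) (integral\<^sup>L \<nu> h) < e"
  proof eventually_elim
    case (elim n)
    have "0 < R" using r by simp
    from approx[OF \<mu> bound, of n] elim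
      approx[OF \<nu> weak_conv_moment_bound[OF \<mu> \<nu> wc this bound]]
    show ?case unfolding dist_real_def by linarith
  qed
qed

section \<open>Normalized designs\<close>

lemma gram_vector_mult_eq_sum: "gram x n *v v = (\<Sum>k=1..n. (x k \<bullet> v) *\<^sub>R x k)"
  by (simp add: vec_eq_iff gram_def matrix_vector_mult_def inner_vec_def sum_distrib_right sum_distrib_left
      sum_component mult_ac) (subst sum.swap, simp add: mult_ac)

lemma design_transpose_mult_eq_sum: "design_transpose_mult x y n = (\<Sum>k=1..n. y k *\<^sub>R x k)"
  by (simp add: vec_eq_iff design_transpose_mult_def sum_component mult.commute)

lemma
  fixes A :: "real^'n^'n"
  assumes "invertible A"
  shows matrix_inv_left: "matrix_inv A ** A = mat 1"
    and matrix_inv_right: "A ** matrix_inv A = mat 1"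
proof -
  have "A ** matrix_inv A = mat 1 \<and> matrix_inv A ** A = mat 1"
    unfolding matrix_inv_def by (rule someI_ex) (use assms in \<open>simp add: invertible_def\<close>)
  then show "matrix_inv A ** A = mat 1" "A ** matrix_inv A = mat 1" by auto
qed

lemma matrix_inv_eqI:
  fixes A B :: "real^'n^'n"
  assumes "A ** B = mat 1" "B ** A = mat 1"
  shows "matrix_inv A = B"
proof -
  have "invertible A" using assms unfolding invertible_def by blast
  then show ?thesis
    using matrix_inv_left[of A] assms(1) by (metis matrix_mul_assoc matrix_mul_lid matrix_mul_rid)
qed

lemma tendsto_det:
  fixes A :: "'b \<Rightarrow> real^'n^'n"
  assumes "(A \<longlongrightarrow> W) F"
  shows "((\<lambda>n. det (A n)) \<longlongrightarrow> det W) F"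
  unfolding det_def by (intro tendsto_intros tendsto_vec_nth assms)

text \<open>Cramer's rule writes the solutions as quotients of determinants, so only the continuity
  of \<open>det\<close> is needed, not that of matrix inversion. Where \<open>det (A n)\<close> is
  0, division by zero makes w n the zero vector, and the equation is claimed only
  eventually.\<close>

lemma linear_system_solution_limit:
  fixes A :: "nat \<Rightarrow> real^'n^'n" and \<alpha> :: "real^'n"
  assumes A: "A \<longlonglongrightarrow> matrix_inv V" and V: "invertible V"
  obtains w where "w \<longlonglongrightarrow> V *v \<alpha>" "\<forall>\<^sub>F n in sequentially. A n *v w n = \<alpha>"
    "\<forall>\<^sub>F n in sequentially. det (A n) \<noteq> 0"
proof -
  \<comment> \<open>\<open>N A k\<close> is A with column k replaced by \<alpha>, the numerator
    matrix in Cramer's rule.\<close>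
  define N where "N = (\<lambda>(A :: real^'n^'n) k. (\<chi> i j. if j = k then \<alpha> $ i else A $ i $ j) :: real^'n^'n)"
  define w where "w = (\<lambda>n. (\<chi> k. det (N (A n) k) / det (A n)) :: real^'n)"
  have inv: "matrix_inv V ** V = mat 1" "V ** matrix_inv V = mat 1"
    using matrix_inv_left[OF V] matrix_inv_right[OF V] by auto
  then have "invertible (matrix_inv V)" unfolding invertible_def by blast
  then have det: "det (matrix_inv V) \<noteq> 0" by (simp add: invertible_det_nz)
  have ev: "\<forall>\<^sub>F n in sequentially. det (A n) \<noteq> 0"
    by (rule tendsto_imp_eventually_ne[OF tendsto_det[OF A] det])
  have sol: "A n *v w n = \<alpha>" if "det (A n) \<noteq> 0" for n
    using cramer[OF that, of "w n" \<alpha>] by (simp add: w_def N_def)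
  have "matrix_inv V *v (V *v \<alpha>) = \<alpha>"
    by (simp add: matrix_vector_mul_assoc inv)
  then have lim: "V *v \<alpha> = (\<chi> k. det (N (matrix_inv V) k) / det (matrix_inv V))"
    using cramer[OF det, of "V *v \<alpha>" \<alpha>] by (simp add: N_def)
  have "(\<lambda>n. N (A n) k) \<longlonglongrightarrow> N (matrix_inv V) k" for k
    unfolding N_def by (intro vec_tendstoI) (auto intro!: tendsto_vec_nth A)
  then have "w \<longlonglongrightarrow> V *v \<alpha>"
    unfolding w_def lim by (intro tendsto_vec_lambda tendsto_divide tendsto_det A det)
  then show thesis
    by (rule that) (use ev sol in \<open>auto elim: eventually_mono\<close>)
qed

text \<open>The common form of both admissible normalizations, with d n i the i-th diagonal entry of
  \<Gamma> n. Row n is measured against its own scale; monotonicity of the scales extends this to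
  all earlier rows.\<close>

locale normalized_design =
  fixes x :: "nat \<Rightarrow> real^'p" and V :: "real^'p^'p" and d :: "nat \<Rightarrow> 'p \<Rightarrow> real"
  assumes scale_at_top: "\<And>i. filterlim (\<lambda>n. d n i) at_top sequentially"
    and scale_mono: "\<And>i m n. m \<le> n \<Longrightarrow> d m i \<le> d n i"
    and row_negligible: "\<And>i. (\<lambda>n. x n $ i / d n i) \<longlonglongrightarrow> 0"
    and invertible_V: "invertible V"
    and gram_limit: "(\<lambda>n. \<chi> i j. gram x n $ i $ j / (d n i * d n j)) \<longlonglongrightarrow> matrix_inv V"
begin

lemma scale_pos_eventually: "\<forall>\<^sub>F n in sequentially. \<forall>i. d n i > 0"
  using scale_at_top by (intro eventually_all_finite) (simp add: filterlim_at_top_dense)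

text \<open>Late rows are small relative to their own scale, which is at most the current one. The
  finitely many early rows are fixed while the scale diverges; the sum of their absolute entries
  bounds them all.\<close>

lemma rows_uniformly_negligible:
  assumes e: "e > 0"
  shows "\<forall>\<^sub>F n in sequentially. \<forall>k\<in>{1..n}. \<bar>x k $ i\<bar> \<le> e * d n i"
proof -
  have "\<forall>\<^sub>F n in sequentially. \<bar>x n $ i / d n i\<bar> < e \<and> d n i > 0"
    using tendstoD[OF row_negligible e] scale_pos_eventually by eventually_elim auto
  then obtain K where K: "\<And>k. k \<ge> K \<Longrightarrow> \<bar>x k $ i / d k i\<bar> < e \<and> d k i > 0"
    unfolding eventually_sequentially by blast
  have "\<forall>\<^sub>F n in sequentially. d n i \<ge> (\<Sum>k<K. \<bar>x k $ i\<bar>) / e"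
    using scale_at_top by (simp add: filterlim_at_top)
  then show ?thesis
  proof eventually_elim
    case (elim n)
    show ?case
    proof
      fix k assume k: "k \<in> {1..n}"
      show "\<bar>x k $ i\<bar> \<le> e * d n i"
      proof (cases "k < K")
        case True
        then have "\<bar>x k $ i\<bar> \<le> (\<Sum>k<K. \<bar>x k $ i\<bar>)" by (intro member_le_sum) auto
        also have "\<dots> \<le> e * d n i" using elim e by (simp add: field_simps)
        finally show ?thesis .
      next
        case False
        then have "\<bar>x k $ i\<bar> \<le> e * d k i" using K[of k] by (auto simp: abs_divide pos_divide_less_eq)
        also have "\<dots> \<le> e * d n i" using k e scale_mono[of k n i] by simp
        finally show ?thesis .
      qed
    qed
  qed
qed

definition weight :: "real^'p \<Rightarrow> nat \<Rightarrow> nat \<Rightarrow> real" where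
  "weight w n k = (\<Sum>j\<in>UNIV. w $ j * x k $ j / d n j)"

text \<open>A convergent w is eventually bounded by b, so it suffices that each of the p scaled
  coordinates of a row is at most e / (b p).\<close>

lemma weight_uniformly_small:
  assumes w: "w \<longlonglongrightarrow> w'" and e: "e > 0"
  shows "\<forall>\<^sub>F n in sequentially. \<forall>k\<in>{1..n}. \<bar>weight (w n) n k\<bar> \<le> e"
proof -
  define b where "b = norm w' + 1"
  have b: "b > 0" unfolding b_def by (intro add_nonneg_pos) auto
  have "\<forall>\<^sub>F n in sequentially. norm (w n) < b"
    by (rule order_tendstoD[OF tendsto_norm[OF w]]) (simp add: b_def)
  moreover have "\<forall>\<^sub>F n in sequentially. \<forall>i. \<forall>k\<in>{1..n}. \<bar>x k $ i\<bar> \<le> e / (b * CARD('p)) * d n i"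
    using b e by (intro eventually_all_finite rows_uniformly_negligible) auto
  moreover note scale_pos_eventually
  ultimately show ?thesis
  proof eventually_elim
    case (elim n)
    show ?case
    proof
      fix k assume k: "k \<in> {1..n}"
      have "\<bar>weight (w n) n k\<bar> \<le> (\<Sum>j\<in>UNIV. \<bar>w n $ j * x k $ j / d n j\<bar>)"
        unfolding weight_def by (rule sum_abs)
      also have "\<dots> \<le> (\<Sum>j\<in>(UNIV :: 'p set). b * (e / (b * CARD('p))))"
      proof (rule sum_mono)
        fix j
        have 1: "\<bar>w n $ j\<bar> \<le> b" using elim component_le_norm_cart[of "w n" j] by simp
        have "\<bar>x k $ j\<bar> / d n j \<le> e / (b * CARD('p))" "\<bar>d n j\<bar> = d n j"
          using elim k by (auto simp: pos_divide_le_eq abs_of_pos simp del: times_divide_eq_left)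
        then have 2: "\<bar>x k $ j / d n j\<bar> \<le> e / (b * CARD('p))" by (simp only: abs_divide)
        have "\<bar>w n $ j\<bar> * \<bar>x k $ j / d n j\<bar> \<le> b * (e / (b * CARD('p)))"
          using b 1 2 by (intro mult_mono) auto
        then show "\<bar>w n $ j * x k $ j / d n j\<bar> \<le> b * (e / (b * CARD('p)))"
          by (simp add: abs_mult abs_divide)
      qed
      also have "\<dots> = e" using b by simp
      finally show "\<bar>weight (w n) n k\<bar> \<le> e" .
    qed
  qed
qed

text \<open>With D the diagonal matrix of the scales and G the Gram matrix, both sides equal w^T
  D^-1 G v, because \<alpha> = D^-1 G D^-1 w and v solves the normal equations for the data u.
  Taking for u the weights yields the sum of squares; taking the errors yields the estimation
  error.\<close>

lemma sum_weight_mult: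
  assumes d: "\<And>i. d n i > 0"
    and w: "(\<chi> i j. gram x n $ i $ j / (d n i * d n j)) *v w = \<alpha>"
    and v: "gram x n *v v = (\<Sum>k=1..n. u k *\<^sub>R x k)"
  shows "(\<Sum>k=1..n. weight w n k * u k) = (\<Sum>i\<in>UNIV. \<alpha> $ i * (d n i * v $ i))"
proof -
  have \<alpha>: "\<alpha> $ i * d n i = (\<Sum>j\<in>UNIV. gram x n $ i $ j / d n j * w $ j)" for i
    unfolding w[symmetric] using d[of i] by (simp add: matrix_vector_mult_def sum_distrib_right)
  have "(\<Sum>i\<in>UNIV. \<alpha> $ i * (d n i * v $ i)) = (\<Sum>i\<in>UNIV. \<Sum>j\<in>UNIV. gram x n $ i $ j / d n j * w $ j * v $ i)"
    by (simp add: mult.assoc[symmetric] \<alpha> sum_distrib_right)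
  \<comment> \<open>The symmetry of the Gram matrix enters here.\<close>
  also have "\<dots> = (\<Sum>j\<in>UNIV. \<Sum>i\<in>UNIV. w $ j / d n j * (gram x n $ j $ i * v $ i))"
    by (subst sum.swap) (simp add: gram_def mult_ac)
  also have "\<dots> = (\<Sum>j\<in>UNIV. w $ j / d n j * (gram x n *v v) $ j)"
    by (simp add: matrix_vector_mult_def sum_distrib_left)
  also have "\<dots> = (\<Sum>j\<in>UNIV. \<Sum>k=1..n. w $ j * x k $ j / d n j * u k)"
    unfolding v by (simp add: sum_component sum_distrib_left mult_ac)
  also have "\<dots> = (\<Sum>k=1..n. weight w n k * u k)"
    by (subst sum.swap) (simp add: weight_def sum_distrib_right)
  finally show ?thesis by simp
qed

text \<open>For v = D^-1 w the fitted values x_k^T v are the weights themselves.\<close>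

lemma sum_weight_squares:
  assumes d: "\<And>i. d n i > 0"
    and w: "(\<chi> i j. gram x n $ i $ j / (d n i * d n j)) *v w = \<alpha>"
  shows "(\<Sum>k=1..n. (weight w n k)\<^sup>2) = \<alpha> \<bullet> w"
proof -
  define v where "v = (\<chi> i. w $ i / d n i)"
  have "gram x n *v v = (\<Sum>k=1..n. weight w n k *\<^sub>R x k)"
    unfolding gram_vector_mult_eq_sum by (intro sum.cong refl arg_cong2[where f = scaleR])
      (simp add: v_def weight_def inner_vec_def mult_ac)
  from sum_weight_mult[OF d w this] show ?thesis
    using d by (simp add: power2_eq_square v_def inner_vec_def less_imp_neq[symmetric])
qed

lemma invertible_gram:
  assumes "\<And>i. d n i > 0" "det (\<chi> i j. gram x n $ i $ j / (d n i * d n j)) \<noteq> 0"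
  shows "invertible (gram x n)"
proof -
  define P :: "real^'p^'p" where "P = (\<chi> i j. if i = j then 1 / d n i else 0)"
  have "(\<chi> i j. gram x n $ i $ j / (d n i * d n j)) = P ** gram x n ** P"
    by (simp add: vec_eq_iff matrix_matrix_mult_def P_def if_distrib if_distribR sum.delta cong: if_cong)
  then show ?thesis using assms(2) by (auto simp: det_mul invertible_det_nz)
qed

text \<open>The estimation error solves the normal equations with the errors u as data, so the
  identity for weighted sums applies without a formula for the inverse Gram matrix.\<close>

lemma estimation_error_eq_weighted_sum:
  assumes d: "\<And>i. d n i > 0"
    and w: "(\<chi> i j. gram x n $ i $ j / (d n i * d n j)) *v w = \<alpha>"
    and det: "det (\<chi> i j. gram x n $ i $ j / (d n i * d n j)) \<noteq> 0"
    and y: "\<And>k. k \<in> {1..n} \<Longrightarrow> y k = x k \<bullet> \<beta> + u k"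
  shows "\<alpha> \<bullet> ((\<chi> i j. if i = j then d n i else 0) *v (ols x y n - \<beta>)) = (\<Sum>k=1..n. weight w n k * u k)"
proof -
  have "gram x n *v (ols x y n - \<beta>) = design_transpose_mult x y n - gram x n *v \<beta>"
    using matrix_inv_right[OF invertible_gram[OF d det]]
    by (simp add: ols_def matrix_vector_mult_diff_distrib matrix_vector_mul_assoc)
  also have "\<dots> = (\<Sum>k=1..n. u k *\<^sub>R x k)"
    unfolding gram_vector_mult_eq_sum design_transpose_mult_eq_sum
    by (simp add: sum_subtractf[symmetric] y scaleR_diff_left[symmetric])
  finally have "(\<Sum>k=1..n. weight w n k * u k) = (\<Sum>i\<in>UNIV. \<alpha> $ i * (d n i * (ols x y n - \<beta>) $ i))"
    by (rule sum_weight_mult[OF d w])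
  then show ?thesis
    by (simp add: inner_vec_def matrix_vector_mult_def if_distrib if_distribR sum.delta cong: if_cong)
qed

end

section \<open>Both admissible normalizations have the common form\<close>

lemma matrix_inv_diagonal:
  fixes c :: "'n::finite \<Rightarrow> real"
  assumes "\<And>i. c i \<noteq> 0"
  shows "matrix_inv (\<chi> i j. if i = j then c i else 0) = (\<chi> i j. if i = j then 1 / c i else 0)"
proof -
  have "(\<chi> i j. if i = j then a i else 0) ** (\<chi> i j. if i = j then b i else 0) = mat 1"
    if "\<And>i. a i * b i = 1" for a b :: "'n \<Rightarrow> real"
  proof -
    have "(\<Sum>k\<in>UNIV. (if i = k then a i else 0) * (if k = j then b k else 0))
        = (\<Sum>k\<in>UNIV. if k = i then (if i = j then 1 else 0) else 0)" for i j
      by (intro sum.cong) (auto simp: that)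
    then show ?thesis by (simp add: vec_eq_iff matrix_matrix_mult_def mat_def)
  qed
  then show ?thesis using assms by (intro matrix_inv_eqI) auto
qed

lemma gram_diag_mono: "m \<le> n \<Longrightarrow> gram x m $ i $ i \<le> gram x n $ i $ i"
  by (auto simp: gram_def intro!: sum_mono2)

lemma normalized_design_diag:
  assumes "diag_normalized_design x V"
  shows "normalized_design x V (\<lambda>n i. sqrt (gram x n $ i $ i))"
proof
  have m: "\<And>i. filterlim (\<lambda>n. gram x n $ i $ i) at_top sequentially"
    and q: "\<And>i. (\<lambda>n. (x (n + 1) $ i)\<^sup>2 / gram x n $ i $ i) \<longlonglongrightarrow> 0"
    and lim: "(\<lambda>n. matrix_inv (diag_scaling x n) ** gram x n ** matrix_inv (diag_scaling x n)) \<longlonglongrightarrow> matrix_inv V"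
    using assms by (auto simp: diag_normalized_design_def)
  have pos: "\<forall>\<^sub>F n in sequentially. \<forall>i. gram x n $ i $ i > 0"
    using m by (intro eventually_all_finite) (simp add: filterlim_at_top_dense)
  show "filterlim (\<lambda>n. sqrt (gram x n $ i $ i)) at_top sequentially" for i
    by (rule filterlim_compose[OF sqrt_at_top m])
  show "sqrt (gram x a $ i $ i) \<le> sqrt (gram x b $ i $ i)" if "a \<le> b" for i a b
    using that by (simp add: gram_diag_mono)
  show "invertible V" using assms by (simp add: diag_normalized_design_def)
  show "(\<lambda>n. x n $ i / sqrt (gram x n $ i $ i)) \<longlonglongrightarrow> 0" for i
  proof -
    \<comment> \<open>Condition (ii) divides row n + 1 by the Gram entry at n. The entry at n + 1 is
      at least as large, so the squared quotient only shrinks.\<close>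
    have "(\<lambda>n. (x (Suc n) $ i / sqrt (gram x (Suc n) $ i $ i))\<^sup>2) \<longlonglongrightarrow> 0"
    proof (rule tendsto_sandwich[OF _ _ tendsto_const q])
      show "\<forall>\<^sub>F n in sequentially. (x (Suc n) $ i / sqrt (gram x (Suc n) $ i $ i))\<^sup>2 \<le> (x (n + 1) $ i)\<^sup>2 / gram x n $ i $ i"
        using pos
      proof eventually_elim
        case (elim n)
        have "0 < gram x n $ i $ i" "gram x n $ i $ i \<le> gram x (Suc n) $ i $ i"
          using elim by (auto intro: gram_diag_mono)
        then show ?case by (auto simp: power_divide intro!: divide_left_mono mult_pos_pos)
      qed
    qed simp
    then have "(\<lambda>n. x (Suc n) $ i / sqrt (gram x (Suc n) $ i $ i)) \<longlonglongrightarrow> 0"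
      by (subst (asm) power_tendsto_0_iff) auto
    then show ?thesis by (rule LIMSEQ_imp_Suc)
  qed
  show "(\<lambda>n. \<chi> i j. gram x n $ i $ j / (sqrt (gram x n $ i $ i) * sqrt (gram x n $ j $ j))) \<longlonglongrightarrow> matrix_inv V"
  proof (rule Lim_transform_eventually[OF lim])
    show "\<forall>\<^sub>F n in sequentially. matrix_inv (diag_scaling x n) ** gram x n ** matrix_inv (diag_scaling x n)
        = (\<chi> i j. gram x n $ i $ j / (sqrt (gram x n $ i $ i) * sqrt (gram x n $ j $ j)))"
      using pos
    proof eventually_elim
      case (elim n)
      have inv: "matrix_inv (diag_scaling x n) = (\<chi> i j. if i = j then 1 / sqrt (gram x n $ i $ i) else 0)"
        unfolding diag_scaling_def by (rule matrix_inv_diagonal) (use elim in \<open>auto simp: less_imp_neq[symmetric]\<close>)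
      show ?case unfolding inv
        by (simp add: vec_eq_iff matrix_matrix_mult_def if_distrib if_distribR sum.delta cong: if_cong)
    qed
  qed
qed

lemma normalized_design_sqrt:
  assumes "sqrt_normalized_design x V"
  shows "normalized_design x V (\<lambda>n i. sqrt (real n))"
proof
  have lim: "(\<lambda>n. (1 / real n) *\<^sub>R gram x n) \<longlonglongrightarrow> matrix_inv V"
    using assms by (simp add: sqrt_normalized_design_def)
  show "filterlim (\<lambda>n. sqrt (real n)) at_top sequentially" for i :: 'a
    by (rule filterlim_compose[OF sqrt_at_top filterlim_real_sequentially])
  show "sqrt (real a) \<le> sqrt (real b)" if "a \<le> b" for a b and i :: 'a
    using that by simp
  show "invertible V" using assms by (simp add: sqrt_normalized_design_def)
  show "(\<lambda>n. \<chi> i j. gram x n $ i $ j / (sqrt (real n) * sqrt (real n))) \<longlonglongrightarrow> matrix_inv V"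
    using lim by (rule Lim_transform_eventually) (auto simp: vec_eq_iff)
  show "(\<lambda>n. x n $ i / sqrt (real n)) \<longlonglongrightarrow> 0" for i
  proof -
    \<comment> \<open>The squared entry of row n + 1 is an increment of the Gram diagonal, so after
      division by n + 1 it equals g (n+1) - n/(n+1) g n, a difference of two sequences with the same
      limit. At n = 0 the division by zero in g is harmless, since the factor n/(n+1) is 0.\<close>
    define g where "g = (\<lambda>n. gram x n $ i $ i / real n)"
    have g: "g \<longlonglongrightarrow> matrix_inv V $ i $ i"
      using tendsto_vec_nth[OF tendsto_vec_nth[OF lim, of i], of i] by (simp add: g_def)
    have "(\<lambda>n. g (Suc n) - real n / real (Suc n) * g n) \<longlonglongrightarrow> matrix_inv V $ i $ i - 1 * matrix_inv V $ i $ i"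
      by (intro tendsto_diff tendsto_mult g LIMSEQ_Suc LIMSEQ_n_over_Suc_n)
    moreover have "(x (Suc n) $ i / sqrt (real (Suc n)))\<^sup>2 = g (Suc n) - real n / real (Suc n) * g n" for n
      by (cases "n = 0") (auto simp: g_def gram_def power_divide power2_eq_square add_divide_distrib)
    ultimately have "(\<lambda>n. (x (Suc n) $ i / sqrt (real (Suc n)))\<^sup>2) \<longlonglongrightarrow> 0" by simp
    then have "(\<lambda>n. x (Suc n) $ i / sqrt (real (Suc n))) \<longlonglongrightarrow> 0"
      by (subst (asm) power_tendsto_0_iff) auto
    then show ?thesis by (rule LIMSEQ_imp_Suc)
  qed
qed

text \<open>For fixed n the estimator is a fixed matrix applied to the data, hence linear even if
  the Gram matrix is singular. This makes xi_n measurable with finite R-th moment for every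
  n.\<close>

lemma ols_functional_affine:
  assumes "\<And>k. k \<in> {1..n} \<Longrightarrow> y k = x k \<bullet> \<beta> + u k"
  shows "\<alpha> \<bullet> (G *v (ols x y n - \<beta>))
    = (\<alpha> \<bullet> (G *v (ols x (\<lambda>k. x k \<bullet> \<beta>) n - \<beta>))) + (\<Sum>k=1..n. (\<alpha> \<bullet> (G *v (matrix_inv (gram x n) *v x k))) * u k)"
proof -
  have "design_transpose_mult x y n = design_transpose_mult x (\<lambda>k. x k \<bullet> \<beta>) n + (\<Sum>k=1..n. u k *\<^sub>R x k)"
    unfolding design_transpose_mult_eq_sum
    by (simp add: sum.distrib[symmetric] assms scaleR_add_left[symmetric])
  then have eq: "ols x y n - \<beta> = (ols x (\<lambda>k. x k \<bullet> \<beta>) n - \<beta>)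
      + (\<Sum>k=1..n. u k *\<^sub>R (matrix_inv (gram x n) *v x k))"
    by (simp add: ols_def matrix_vector_right_distrib linear_sum[OF matrix_vector_mul_linear]
        linear_scale[OF matrix_vector_mul_linear])
  show ?thesis unfolding eq
    by (simp add: matrix_vector_right_distrib linear_sum[OF matrix_vector_mul_linear]
        linear_scale[OF matrix_vector_mul_linear] inner_add_right inner_sum_right mult.commute)
qed

section \<open>The regression model\<close>

context prob_space
begin

text \<open>Eventually all |a n k| <= 1, and then |a n k|^R <= (a n k)^2 by R >= 2. Second and R-th
  moments of the summands are thus both dominated by the squares, whose sum is eventually below
  \<tau> + 1.\<close>

lemma moment_weighted_sum_bounded:
  fixes X :: "nat \<Rightarrow> 'a \<Rightarrow> real" and a :: "nat \<Rightarrow> nat \<Rightarrow> real"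
  assumes R: "R \<ge> 2" and indep: "indep_vars (\<lambda>_. borel) X {1..}"
    and X: "\<And>i. i \<ge> 1 \<Longrightarrow> integrable M (X i)" "\<And>i. i \<ge> 1 \<Longrightarrow> integrable M (\<lambda>\<omega>. (X i \<omega>)\<^sup>2)"
      "\<And>i. i \<ge> 1 \<Longrightarrow> expectation (X i) = 0" "\<And>i. i \<ge> 1 \<Longrightarrow> variance (X i) = v"
    and XR: "\<And>i. i \<ge> 1 \<Longrightarrow> integrable M (\<lambda>\<omega>. \<bar>X i \<omega>\<bar> powr R)"
      "\<And>i. i \<ge> 1 \<Longrightarrow> expectation (\<lambda>\<omega>. \<bar>X i \<omega>\<bar> powr R) \<le> K"
    and sq: "(\<lambda>n. \<Sum>k=1..n. (a n k)\<^sup>2) \<longlonglongrightarrow> \<tau>"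
    and small: "\<And>e. e > 0 \<Longrightarrow> \<forall>\<^sub>F n in sequentially. \<forall>k\<in>{1..n}. \<bar>a n k\<bar> \<le> e"
  obtains D where
    "\<forall>\<^sub>F n in sequentially. expectation (\<lambda>\<omega>. \<bar>\<Sum>k=1..n. a n k * X k \<omega>\<bar> powr R) \<le> D"
proof -
  obtain C where C: "C > 0" "\<And>x y :: real. \<bar>x + y\<bar> powr R
      \<le> \<bar>x\<bar> powr R + R * (sgn x * \<bar>x\<bar> powr (R - 1)) * y + C * ((1 + \<bar>x\<bar> powr R) * y\<^sup>2 + \<bar>y\<bar> powr R)"
    using powr_abs_Taylor_bound[OF R] by blast
  have v: "v \<ge> 0" using X(4)[of 1] by auto
  have v2: "expectation (\<lambda>\<omega>. (X i \<omega>)\<^sup>2) = v" if "i \<ge> 1" for i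
    using X(3,4)[OF that] by auto
  have K: "K \<ge> 0" by (rule order_trans[OF _ XR(2)[of 1]]) auto
  have "\<forall>\<^sub>F n in sequentially. \<forall>k\<in>{1..n}. \<bar>a n k\<bar> \<le> 1" by (rule small) simp
  moreover have "\<forall>\<^sub>F n in sequentially. (\<Sum>k=1..n. (a n k)\<^sup>2) < \<tau> + 1"
    by (rule order_tendstoD[OF sq]) simp
  ultimately have "\<forall>\<^sub>F n in sequentially.
      expectation (\<lambda>\<omega>. \<bar>\<Sum>k=1..n. a n k * X k \<omega>\<bar> powr R) \<le> exp (C * ((\<tau> + 1) * (v + K)))"
  proof eventually_elim
    case (elim n)
    have iR: "integrable M (\<lambda>\<omega>. \<bar>a n k * X k \<omega>\<bar> powr R)" if "k \<in> {1..n}" for k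
      using XR(1)[of k] that by (simp add: abs_mult powr_mult)
    have "expectation (\<lambda>\<omega>. (a n k * X k \<omega>)\<^sup>2) + expectation (\<lambda>\<omega>. \<bar>a n k * X k \<omega>\<bar> powr R)
        \<le> (a n k)\<^sup>2 * (v + K)" if k: "k \<in> {1..n}" for k
    proof -
      have "\<bar>a n k\<bar> powr R \<le> \<bar>a n k\<bar> powr 2"
        using R elim(1) k by (intro powr_mono') auto
      then have "\<bar>a n k\<bar> powr R \<le> (a n k)\<^sup>2" by simp
      then have "\<bar>a n k\<bar> powr R * expectation (\<lambda>\<omega>. \<bar>X k \<omega>\<bar> powr R) \<le> (a n k)\<^sup>2 * K"
        using XR(2)[of k] k by (intro mult_mono) auto
      then show ?thesis
        using k v2[of k] by (simp add: power_mult_distrib abs_mult powr_mult distrib_left)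
    qed
    then have "(\<Sum>k=1..n. expectation (\<lambda>\<omega>. (a n k * X k \<omega>)\<^sup>2) + expectation (\<lambda>\<omega>. \<bar>a n k * X k \<omega>\<bar> powr R))
        \<le> (\<Sum>k=1..n. (a n k)\<^sup>2 * (v + K))"
      by (rule sum_mono)
    also have "\<dots> = (\<Sum>k=1..n. (a n k)\<^sup>2) * (v + K)" by (simp add: sum_distrib_right)
    also have "\<dots> \<le> (\<tau> + 1) * (v + K)" using elim v K by (intro mult_right_mono) auto
    finally have le: "(\<Sum>k=1..n. expectation (\<lambda>\<omega>. (a n k * X k \<omega>)\<^sup>2) + expectation (\<lambda>\<omega>. \<bar>a n k * X k \<omega>\<bar> powr R))
        \<le> (\<tau> + 1) * (v + K)" .
    have "1 + expectation (\<lambda>\<omega>. \<bar>\<Sum>k=1..n. a n k * X k \<omega>\<bar> powr R)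
        \<le> exp (C * (\<Sum>k=1..n. expectation (\<lambda>\<omega>. (a n k * X k \<omega>)\<^sup>2) + expectation (\<lambda>\<omega>. \<bar>a n k * X k \<omega>\<bar> powr R)))"
    proof (rule moment_sum_indep_bound[OF R C])
      show "indep_vars (\<lambda>_. borel) (\<lambda>k \<omega>. a n k * X k \<omega>) {1..n}"
        using indep_vars_compose2[OF indep_vars_subset[OF indep, of "{1..n}"],
            of "\<lambda>k x. a n k * x" "\<lambda>_. borel"] by auto
    qed (use X iR in \<open>auto simp: power_mult_distrib\<close>)
    also have "\<dots> \<le> exp (C * ((\<tau> + 1) * (v + K)))"
      using le C(1) by simp
    finally show ?case by linarith
  qed
  then show thesis by (rule that)
qed

text \<open>Restates the tail condition in the form that the Lindeberg estimate consumes: one level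
  c for all i, chosen nonnegative since the limit is taken at infinity.\<close>

lemma error_tail_condition_expectation:
  fixes X :: "nat \<Rightarrow> 'a \<Rightarrow> real"
  assumes tail: "error_tail_condition M X" and e: "e > 0"
    and rv: "\<And>i. i \<ge> 1 \<Longrightarrow> X i \<in> borel_measurable M"
    and X2: "\<And>i. i \<ge> 1 \<Longrightarrow> integrable M (\<lambda>\<omega>. (X i \<omega>)\<^sup>2)"
  shows "\<exists>c\<ge>0. \<forall>i\<ge>1. expectation (\<lambda>\<omega>. (X i \<omega>)\<^sup>2 * indicator {\<omega>. c < \<bar>X i \<omega>\<bar>} \<omega>) \<le> e"
proof -
  let ?T = "\<lambda>i c. \<integral>\<^sup>+u. ennreal (u\<^sup>2) * indicator {u. c < \<bar>u\<bar>} u \<partial>distr M borel (X i)"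
  have "\<forall>\<^sub>F c::real in at_top. (SUP i\<in>{1..}. ?T i c) < ennreal e"
    using tail e unfolding error_tail_condition_def by (intro order_tendstoD) auto
  then have "\<forall>\<^sub>F c::real in at_top. (SUP i\<in>{1..}. ?T i c) < ennreal e \<and> c \<ge> 0"
    using eventually_ge_at_top by (rule eventually_conj)
  then obtain c :: real where c: "(SUP i\<in>{1..}. ?T i c) < ennreal e" "c \<ge> 0"
    using eventually_happens'[OF trivial_limit_at_top_linorder] by blast
  have "expectation (\<lambda>\<omega>. (X i \<omega>)\<^sup>2 * indicator {\<omega>. c < \<bar>X i \<omega>\<bar>} \<omega>) \<le> e" if i: "i \<ge> 1" for i
  proof -
    note [measurable] = rv[OF i]
    have int: "integrable M (\<lambda>\<omega>. (X i \<omega>)\<^sup>2 * indicator {\<omega>. c < \<bar>X i \<omega>\<bar>} \<omega>)"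
      by (rule Bochner_Integration.integrable_bound[OF X2[OF i]]) (auto intro!: AE_I2 simp: indicator_def)
    have "ennreal (expectation (\<lambda>\<omega>. (X i \<omega>)\<^sup>2 * indicator {\<omega>. c < \<bar>X i \<omega>\<bar>} \<omega>))
        = (\<integral>\<^sup>+\<omega>. ennreal ((X i \<omega>)\<^sup>2 * indicator {\<omega>. c < \<bar>X i \<omega>\<bar>} \<omega>) \<partial>M)"
      by (rule nn_integral_eq_integral[OF int, symmetric]) auto
    also have "\<dots> = ?T i c"
      by (subst nn_integral_distr) (auto intro!: nn_integral_cong simp: indicator_def)
    also have "\<dots> \<le> (SUP i\<in>{1..}. ?T i c)" using i by (intro SUP_upper) auto
    also have "\<dots> \<le> ennreal e" using c(1) by simp
    finally show ?thesis using e by simp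
  qed
  then show ?thesis using c(2) by blast
qed

end

lemma admissible_normalization_cases:
  assumes "admissible_normalization M x \<epsilon> \<Gamma> V"
  obtains d where "normalized_design x V d" "\<And>n. \<Gamma> n = (\<chi> i j. if i = j then d n i else 0)"
proof (cases "diag_normalized_design x V \<and> \<Gamma> = diag_scaling x")
  case True
  then show thesis
    by (intro that[OF normalized_design_diag]) (auto simp: diag_scaling_def vec_eq_iff)
next
  case False
  then have "sqrt_normalized_design x V" "\<Gamma> = (\<lambda>n. sqrt (real n) *\<^sub>R mat 1)"
    using assms by (auto simp: admissible_normalization_def)
  then show thesis
    by (intro that[OF normalized_design_sqrt]) (auto simp: mat_def vec_eq_iff)
qed

text \<open>The finitely many exceptional terms are absorbed by their sum. In the regression model
  they may include the n with singular Gram matrix.\<close>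

lemma bounded_of_eventually_bounded:
  fixes e :: "nat \<Rightarrow> real"
  assumes "\<forall>\<^sub>F n in sequentially. e n \<le> D" and nn: "\<And>n. e n \<ge> 0"
  obtains C where "C \<ge> 0" "\<And>n. e n \<le> C"
proof -
  obtain N where N: "\<And>n. n \<ge> N \<Longrightarrow> e n \<le> D"
    using assms(1) unfolding eventually_sequentially by blast
  have "e n \<le> max D (\<Sum>n<N. e n)" for n
  proof (cases "n < N")
    case True
    then have "e n \<le> (\<Sum>n<N. e n)" using nn by (intro member_le_sum) auto
    then show ?thesis by simp
  qed (use N[of n] in simp)
  moreover have "0 \<le> max D (\<Sum>n<N. e n)" using nn by (simp add: sum_nonneg max.coboundedI2)
  ultimately show thesis by (rule that[rotated])
qed

theorem theorem1:
  fixes M :: "'w measure" and N :: "'v measure"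
    and \<beta> \<alpha> :: "real^'p" and x :: "nat \<Rightarrow> real^'p"
    and \<epsilon> Y :: "nat \<Rightarrow> 'w \<Rightarrow> real" and \<sigma> R r :: real
    and \<Gamma> :: "nat \<Rightarrow> real^'p^'p" and V :: "real^'p^'p"
    and \<xi>n :: "nat \<Rightarrow> 'w \<Rightarrow> real" and \<xi> :: "'v \<Rightarrow> real"
  assumes "R \<ge> 2"
    and "LM R M \<beta> x \<epsilon> \<sigma> Y"
    and "admissible_normalization M x \<epsilon> \<Gamma> V"
    and "\<xi>n = (\<lambda>n \<omega>. \<alpha> \<bullet> (\<Gamma> n *v (ols x (\<lambda>k. Y k \<omega>) n - \<beta>)))"
    and "prob_space N" and "\<xi> \<in> borel_measurable N"
    and "distr N borel \<xi> = normal_law 0 (\<sigma>\<^sup>2 * (\<alpha> \<bullet> (V *v \<alpha>)))"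
    and "0 < r" and "r < R"
  shows "uniformly_integrable M {n. design_rank x n = CARD('p)} (\<lambda>n \<omega>. \<bar>\<xi>n n \<omega>\<bar> powr r)
    \<and> (\<lambda>n. \<integral>\<omega>. \<bar>\<xi>n n \<omega>\<bar> powr r \<partial>M) \<longlonglongrightarrow> (\<integral>\<omega>. \<bar>\<xi> \<omega>\<bar> powr r \<partial>N)
    \<and> (\<forall>k::nat. r = real k \<longrightarrow> (\<lambda>n. \<integral>\<omega>. \<xi>n n \<omega> ^ k \<partial>M) \<longlonglongrightarrow> (\<integral>\<omega>. \<xi> \<omega> ^ k \<partial>N))"
proof -
  have lr: "linear_regression M \<beta> x \<epsilon> \<sigma> Y"
    and SK: "(SUP i\<in>{1..}. \<integral>\<^sup>+\<omega>. ennreal (\<bar>\<epsilon> i \<omega>\<bar> powr R) \<partial>M) < \<infinity>"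
    using assms(2) by (auto simp: LM_def)
  interpret linear_regression M \<beta> x \<epsilon> \<sigma> Y by (fact lr)
  have R: "R \<ge> 2" and r: "0 < r" "r < R" by fact+
  have tail: "error_tail_condition M \<epsilon>"
    using assms(3) by (auto simp: admissible_normalization_def)
  have rv[measurable]: "i \<ge> 1 \<Longrightarrow> \<epsilon> i \<in> borel_measurable M" for i
    using indep_errors by (auto simp: indep_vars_def)
  obtain d where "normalized_design x V d" and \<Gamma>: "\<And>n. \<Gamma> n = (\<chi> i j. if i = j then d n i else 0)"
    using admissible_normalization_cases[OF assms(3)] by blast
  then interpret D: normalized_design x V d by simp

  define K where "K = enn2real (SUP i\<in>{1..}. \<integral>\<^sup>+\<omega>. ennreal (\<bar>\<epsilon> i \<omega>\<bar> powr R) \<partial>M)"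
  have nnK: "(\<integral>\<^sup>+\<omega>. ennreal (\<bar>\<epsilon> i \<omega>\<bar> powr R) \<partial>M) \<le> ennreal K" if "i \<ge> 1" for i
    using SK that unfolding K_def by (subst ennreal_enn2real) (auto intro!: SUP_upper)
  have iR: "integrable M (\<lambda>\<omega>. \<bar>\<epsilon> i \<omega>\<bar> powr R)" if "i \<ge> 1" for i
    using nnK[OF that] rv[OF that] by (intro integrableI_nonneg) (auto intro: le_less_trans)
  have eK: "expectation (\<lambda>\<omega>. \<bar>\<epsilon> i \<omega>\<bar> powr R) \<le> K" if "i \<ge> 1" for i
    using nnK[OF that] nn_integral_eq_integral[OF iR[OF that]] by (simp add: K_def)

  obtain w where w: "w \<longlonglongrightarrow> V *v \<alpha>"
    "\<forall>\<^sub>F n in sequentially. (\<chi> i j. gram x n $ i $ j / (d n i * d n j)) *v w n = \<alpha>"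
    "\<forall>\<^sub>F n in sequentially. det (\<chi> i j. gram x n $ i $ j / (d n i * d n j)) \<noteq> 0"
    using linear_system_solution_limit[OF D.gram_limit D.invertible_V] by blast
  define a where "a = (\<lambda>n k. D.weight (w n) n k)"
  define \<tau> where "\<tau> = \<alpha> \<bullet> (V *v \<alpha>)"
  have small: "\<forall>\<^sub>F n in sequentially. \<forall>k\<in>{1..n}. \<bar>a n k\<bar> \<le> e" if "e > 0" for e
    unfolding a_def by (rule D.weight_uniformly_small[OF w(1) that])
  have sq: "(\<lambda>n. \<Sum>k=1..n. (a n k)\<^sup>2) \<longlonglongrightarrow> \<tau>"
  proof (rule Lim_transform_eventually)
    show "(\<lambda>n. \<alpha> \<bullet> w n) \<longlonglongrightarrow> \<tau>" unfolding \<tau>_def by (intro tendsto_intros w)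
    show "\<forall>\<^sub>F n in sequentially. \<alpha> \<bullet> w n = (\<Sum>k=1..n. (a n k)\<^sup>2)"
      using w(2) D.scale_pos_eventually
      by eventually_elim (simp only: a_def D.sum_weight_squares)
  qed
  have \<tau>: "\<tau> \<ge> 0" by (rule tendsto_lowerbound[OF sq]) (auto intro!: always_eventually sum_nonneg)
  have rep: "\<forall>\<^sub>F n in sequentially. \<forall>\<omega>\<in>space M. \<xi>n n \<omega> = (\<Sum>k=1..n. a n k * \<epsilon> k \<omega>)"
    using w(2,3) D.scale_pos_eventually
  proof eventually_elim
    case (elim n)
    have "0 < d n i" for i using elim by blast
    from D.estimation_error_eq_weighted_sum[OF this elim(1,2)] show ?case
      unfolding assms(4) \<Gamma> a_def by (simp add: response)
  qed

  \<comment> \<open>For singular \<open>gram x n\<close> the value of \<open>matrix_inv\<close> is unspecified but does not depend on \<open>\<omega>\<close>,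
    so only the constant term changes.\<close>
  have affine: "\<xi>n n \<omega> = \<alpha> \<bullet> (\<Gamma> n *v (ols x (\<lambda>k. x k \<bullet> \<beta>) n - \<beta>))
      + (\<Sum>k=1..n. (\<alpha> \<bullet> (\<Gamma> n *v (matrix_inv (gram x n) *v x k))) * \<epsilon> k \<omega>)" if "\<omega> \<in> space M" for n \<omega>
    unfolding assms(4) by (rule ols_functional_affine) (simp add: response that)
  have \<xi>m[measurable]: "\<xi>n n \<in> borel_measurable M" for n
    by (subst measurable_cong[OF affine]) auto
  have \<xi>R: "integrable M (\<lambda>\<omega>. \<bar>\<xi>n n \<omega>\<bar> powr R)" for n
  proof -
    have "integrable M (\<lambda>\<omega>. \<bar>\<alpha> \<bullet> (\<Gamma> n *v (ols x (\<lambda>k. x k \<bullet> \<beta>) n - \<beta>))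
      + (\<Sum>k=1..n. (\<alpha> \<bullet> (\<Gamma> n *v (matrix_inv (gram x n) *v x k))) * \<epsilon> k \<omega>)\<bar> powr R)"
      using R iR by (intro integrable_powr_abs_add integrable_powr_abs_sum)
        (auto simp: abs_mult powr_mult)
    also have "?this \<longleftrightarrow> integrable M (\<lambda>\<omega>. \<bar>\<xi>n n \<omega>\<bar> powr R)"
      by (intro Bochner_Integration.integrable_cong refl) (simp add: affine)
    finally show ?thesis .
  qed

  obtain B where "\<forall>\<^sub>F n in sequentially. expectation (\<lambda>\<omega>. \<bar>\<Sum>k=1..n. a n k * \<epsilon> k \<omega>\<bar> powr R) \<le> B"
    using moment_weighted_sum_bounded[OF R indep_errors integrable_error square_integrable_error
        mean_error variance_error iR eK sq small] by blast
  with rep have "\<forall>\<^sub>F n in sequentially. expectation (\<lambda>\<omega>. \<bar>\<xi>n n \<omega>\<bar> powr R) \<le> B"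
  proof eventually_elim
    case (elim n)
    have "expectation (\<lambda>\<omega>. \<bar>\<xi>n n \<omega>\<bar> powr R) = expectation (\<lambda>\<omega>. \<bar>\<Sum>k=1..n. a n k * \<epsilon> k \<omega>\<bar> powr R)"
      using elim(1) by (intro Bochner_Integration.integral_cong) auto
    then show ?case using elim(2) by simp
  qed
  then obtain C where C: "C \<ge> 0" "\<And>n. expectation (\<lambda>\<omega>. \<bar>\<xi>n n \<omega>\<bar> powr R) \<le> C"
    using bounded_of_eventually_bounded[where e = "\<lambda>n. expectation (\<lambda>\<omega>. \<bar>\<xi>n n \<omega>\<bar> powr R)"] by auto
  \<comment> \<open>A Bochner integral defaults to 0 for nonintegrable functions, so the bound on
    expectations becomes a bound on moments only through \<open>\<xi>R\<close>, which holds for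
    every n.\<close>
  have nnC: "(\<integral>\<^sup>+\<omega>. ennreal (\<bar>\<xi>n n \<omega>\<bar> powr R) \<partial>M) \<le> ennreal C" for n
    using C by (subst nn_integral_eq_integral[OF \<xi>R]) (auto intro!: ennreal_leI)

  define \<nu> where "\<nu> = normal_law 0 (\<sigma>\<^sup>2 * \<tau>)"
  have v: "\<sigma>\<^sup>2 * \<tau> \<ge> 0" using \<tau> by simp
  have rd: "real_distribution (distr M borel (\<xi>n n))" for n
    by (rule real_distribution_distr) simp
  have rd\<nu>: "real_distribution \<nu>" unfolding \<nu>_def by (rule real_distribution_normal_law[OF v])
  have wc: "weak_conv_m (\<lambda>n. distr M borel (\<xi>n n)) \<nu>"
  proof (rule levy_continuity[OF rd rd\<nu>])
    fix t
    have "(\<lambda>n. char (distr M borel (\<lambda>\<omega>. \<Sum>k=1..n. a n k * \<epsilon> k \<omega>)) t) \<longlonglongrightarrow> exp (- (t\<^sup>2 * (\<sigma>\<^sup>2 * \<tau>) / 2))"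
      by (rule char_weighted_sum_limit[OF indep_errors integrable_error square_integrable_error
            mean_error variance_error error_tail_condition_expectation[OF tail _ rv square_integrable_error]
            sq small])
    moreover have "\<forall>\<^sub>F n in sequentially. char (distr M borel (\<lambda>\<omega>. \<Sum>k=1..n. a n k * \<epsilon> k \<omega>)) t
        = char (distr M borel (\<xi>n n)) t"
      using rep
    proof eventually_elim
      case (elim n)
      have "distr M borel (\<lambda>\<omega>. \<Sum>k=1..n. a n k * \<epsilon> k \<omega>) = distr M borel (\<xi>n n)"
        using elim by (intro distr_cong) auto
      then show ?case by simp
    qed
    ultimately show "(\<lambda>n. char (distr M borel (\<xi>n n)) t) \<longlonglongrightarrow> char \<nu> t"
      unfolding \<nu>_def char_normal_law[OF v] by (rule Lim_transform_eventually)
  qed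
  have conv: "(\<lambda>n. \<integral>\<omega>. h (\<xi>n n \<omega>) \<partial>M) \<longlonglongrightarrow> (\<integral>\<omega>. h (\<xi> \<omega>) \<partial>N)"
    if h: "\<And>y. isCont h y" "\<And>y. \<bar>h y\<bar> \<le> \<bar>y\<bar> powr r" for h :: "real \<Rightarrow> real"
  proof -
    have hm: "h \<in> borel_measurable borel"
      by (intro borel_measurable_continuous_onI continuous_at_imp_continuous_on ballI h)
    have "(\<integral>\<^sup>+y. ennreal (\<bar>y\<bar> powr R) \<partial>distr M borel (\<xi>n n)) \<le> ennreal C" for n
      using nnC[of n] by (simp add: nn_integral_distr)
    from weak_conv_moment_convergence[OF rd rd\<nu> wc r C(1) this h]
    have "(\<lambda>n. integral\<^sup>L (distr M borel (\<xi>n n)) h) \<longlonglongrightarrow> integral\<^sup>L (distr N borel \<xi>) h"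
      unfolding assms(7) \<nu>_def \<tau>_def .
    then show ?thesis using hm assms(6) by (simp add: integral_distr)
  qed
  show ?thesis
  proof (intro conjI allI impI)
    show "uniformly_integrable M {n. design_rank x n = CARD('p)} (\<lambda>n \<omega>. \<bar>\<xi>n n \<omega>\<bar> powr r)"
      by (rule uniformly_integrable_powr[OF r \<xi>m nnC C(1)])
    show "(\<lambda>n. \<integral>\<omega>. \<bar>\<xi>n n \<omega>\<bar> powr r \<partial>M) \<longlonglongrightarrow> (\<integral>\<omega>. \<bar>\<xi> \<omega>\<bar> powr r \<partial>N)"
      using r(1) by (intro conv isCont_powr_abs) auto
    fix k :: nat assume k: "r = real k"
    \<comment> \<open>Positivity of r makes k positive, so both sides are 0 at y = 0.\<close>
    have "\<bar>y ^ k\<bar> \<le> \<bar>y\<bar> powr r" for y :: real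
      using r(1) by (cases "y = 0") (auto simp: k powr_realpow power_abs zero_power)
    then show "(\<lambda>n. \<integral>\<omega>. \<xi>n n \<omega> ^ k \<partial>M) \<longlonglongrightarrow> (\<integral>\<omega>. \<xi> \<omega> ^ k \<partial>N)"
      by (intro conv) (auto intro: continuous_intros)
  qed
qed

end
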